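(* Let $\omega$ be a weight function on a locally compact infinite group $G$. Then the following statements hold. (i) $Wap(G,1/\omega)=C_b(G,1/\omega)$ if and only if $G$ is compact or $\Omega$ is zero cluster. (ii) $Ap(G,1/\omega)=C_b(G,1/\omega)$ if and only if $G$ is either compact or discrete and $\Omega\in C_0(G\times G)$.
   Context: All groups are Hausdorff locally compact. A weight (weight function) on $G$ is a continuous function $\omega:G\to[1,\infty)$ with $\omega(e)=1$ and $\omega(xy)\le\omega(x)\omega(y)$ for all $x,y\in G$. Define $\Omega:G\times G\to(0,1]$ by $\Omega(x,y)=\omega(xy)/(\omega(x)\omega(y))$. A function $F:G\times G\to\mathbb{C}$ is zero cluster if for every pair of sequences $(x_n)_n$ and $(y_m)_m$ of distinct elements of $G$, $\lim_n\lim_m F(x_n,y_m)=\lim_m\lim_n F(x_n,y_m)=0$ whenever both iterated limits exist. $C_b(G)$ is the space of bounded continuous functions on $G$, and $C_b(G,1/\omega)$ is the space of functions $f$ on $G$ with $f/\omega\in C_b(G)$. Write ${}_xf(y)=f(yx)$. A function $f\in C_b(G,1/\omega)$ is $\omega$-weakly almost periodic (respectively, $\omega$-almost periodic) if the set $\{\frac{{}_xf}{\omega(x)\omega}:x\in G\}$ is relatively weakly (respectively, norm) compact in $C_b(G)$. The sets of all such functions are $Wap(G,1/\omega)$ and $Ap(G,1/\omega)$, respectively.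
   Formalization: In (ii), Ω∈C_0(G×G) is replaced by: Ω is continuous and for each ε>0 there is a compact K with |Ω(x,y)|<ε when both x,y∉K; the usual C_0 forces G compact since Ω(e,y)=1, and (ii) then fails for G=ℤ, ω(n)=1+|n|. *)

theory Defs
  imports "HOL-Analysis.Analysis"
begin

(* The group is a type of class topological_group_add. Addition in that class is not assumed to
   be commutative, so x + y is the product xy of a general topological group and 0 is its
   identity e. *)

definition weight :: "('a::topological_group_add \<Rightarrow> real) \<Rightarrow> bool" where
  "weight \<omega> \<longleftrightarrow> continuous_on UNIV \<omega> \<and> (\<forall>x. 1 \<le> \<omega> x) \<and> \<omega> 0 = 1 \<and>
     (\<forall>x y. \<omega> (x + y) \<le> \<omega> x * \<omega> y)"

definition Omega :: "('a::topological_group_add \<Rightarrow> real) \<Rightarrow> 'a \<times> 'a \<Rightarrow> complex" where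
  "Omega \<omega> = (\<lambda>(x, y). complex_of_real (\<omega> (x + y) / (\<omega> x * \<omega> y)))"

definition iterated_limit :: "(nat \<Rightarrow> nat \<Rightarrow> complex) \<Rightarrow> complex \<Rightarrow> bool" where
  "iterated_limit F l \<longleftrightarrow> (\<exists>L. (\<forall>n. (\<lambda>m. F n m) \<longlonglongrightarrow> L n) \<and> L \<longlonglongrightarrow> l)"

definition zero_cluster :: "('a \<times> 'a \<Rightarrow> complex) \<Rightarrow> bool" where
  "zero_cluster F \<longleftrightarrow>
     (\<forall>x y :: nat \<Rightarrow> 'a. \<forall>a b. inj x \<longrightarrow> inj y \<longrightarrow>
        iterated_limit (\<lambda>n m. F (x n, y m)) a \<longrightarrow>
        iterated_limit (\<lambda>m n. F (x n, y m)) b \<longrightarrow> a = 0 \<and> b = 0)"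

(* Vanishing at infinity is required only when both variables leave a compact set, which is weaker
   than membership in the usual C_0(G x G) (smallness off a compact subset of the product). The
   usual condition is not the intended one here: Omega equals 1 on {e} x G, so it would force G to
   be compact (see Omega_vanishes_imp_compact below), whereas for the weight 1 + |n| on the
   integers every function in C_b(Z, 1/omega) is omega-almost periodic. *)
definition C0_joint :: "('a::topological_space \<times> 'a \<Rightarrow> complex) set" where
  "C0_joint = {F. continuous_on UNIV F \<and>
     (\<forall>\<epsilon>>0. \<exists>K. compact K \<and> (\<forall>x y. x \<notin> K \<longrightarrow> y \<notin> K \<longrightarrow> norm (F (x, y)) < \<epsilon>))}"

definition Cb_weighted :: "('a::topological_group_add \<Rightarrow> real) \<Rightarrow> ('a \<Rightarrow> complex) set" where
  "Cb_weighted \<omega> = {f. (\<lambda>x. f x / complex_of_real (\<omega> x)) \<in> bcontfun}"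

definition weighted_translate ::
    "('a::topological_group_add \<Rightarrow> real) \<Rightarrow> ('a \<Rightarrow> complex) \<Rightarrow> 'a \<Rightarrow> ('a \<Rightarrow>\<^sub>C complex)" where
  "weighted_translate \<omega> f x = Bcontfun (\<lambda>y. f (y + x) / complex_of_real (\<omega> x * \<omega> y))"

(* The library's bounded_linear is linearity over the reals; the second clause adds complex
   homogeneity, which has to be spelled out since bcontfun has no complex scalar
   multiplication. *)
definition Cb_dual :: "(('a::topological_space \<Rightarrow>\<^sub>C complex) \<Rightarrow> complex) set" where
  "Cb_dual = {\<phi>. bounded_linear \<phi> \<and>
     (\<forall>c g. \<phi> (Bcontfun (\<lambda>y. c * apply_bcontfun g y)) = c * \<phi> g)}"

definition weak_topology_Cb :: "('a::topological_space \<Rightarrow>\<^sub>C complex) topology" where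
  "weak_topology_Cb = topology_generated_by {\<phi> -` U | \<phi> U. \<phi> \<in> Cb_dual \<and> open U}"

definition Wap :: "('a::topological_group_add \<Rightarrow> real) \<Rightarrow> ('a \<Rightarrow> complex) set" where
  "Wap \<omega> = {f \<in> Cb_weighted \<omega>.
     compactin weak_topology_Cb (weak_topology_Cb closure_of range (weighted_translate \<omega> f))}"

definition Ap :: "('a::topological_group_add \<Rightarrow> real) \<Rightarrow> ('a \<Rightarrow> complex) set" where
  "Ap \<omega> = {f \<in> Cb_weighted \<omega>. compact (closure (range (weighted_translate \<omega> f)))}"

text \<open>The arguments of \<^const>\<open>Bcontfun\<close> above are indeed bounded continuous functions, and the
  weak topology lives on the whole space.\<close>

lemma weighted_translate_in_bcontfun:
  fixes \<omega> :: "'a::topological_group_add \<Rightarrow> real"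
  assumes w: "weight \<omega>" and f: "f \<in> Cb_weighted \<omega>"
  shows "(\<lambda>y. f (y + x) / complex_of_real (\<omega> x * \<omega> y)) \<in> bcontfun"
proof -
  define g where "g = (\<lambda>x. f x / complex_of_real (\<omega> x))"
  have cw: "continuous_on UNIV \<omega>" and ge1: "\<And>x. 1 \<le> \<omega> x"
    and sub: "\<And>x y. \<omega> (x + y) \<le> \<omega> x * \<omega> y"
    using w by (auto simp: weight_def)
  have pos: "\<omega> z > 0" for z using ge1[of z] by linarith
  have nz: "\<omega> z \<noteq> 0" for z using pos[of z] by linarith
  have cg: "continuous_on UNIV g" and bg: "bounded (range g)"
    using f by (auto simp: Cb_weighted_def bcontfun_def g_def)
  have eq: "f (y + x) / complex_of_real (\<omega> x * \<omega> y) =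
      g (y + x) * complex_of_real (\<omega> (y + x) / (\<omega> x * \<omega> y))" for y
    using nz[of "y + x"] by (simp add: g_def)
  have t: "continuous_on UNIV (\<lambda>y. y + x)" by (intro continuous_intros)
  have c: "continuous_on UNIV (\<lambda>y. g (y + x) * complex_of_real (\<omega> (y + x) / (\<omega> x * \<omega> y)))"
    by (intro continuous_intros continuous_on_compose2[OF cg t] continuous_on_compose2[OF cw t] cw)
       (auto simp: nz)
  obtain B where B: "\<And>z. norm (g z) \<le> B" using bg by (auto simp: bounded_iff)
  have "norm (g (y + x) * complex_of_real (\<omega> (y + x) / (\<omega> x * \<omega> y))) \<le> B" for y
  proof -
    have r1: "\<omega> (y + x) / (\<omega> x * \<omega> y) \<le> 1"
      using sub[of y x] pos[of x] pos[of y] by (simp add: divide_le_eq_1 mult.commute)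
    have r0: "0 \<le> \<omega> (y + x) / (\<omega> x * \<omega> y)"
      using pos[of x] pos[of y] pos[of "y + x"] by simp
    have "norm (g (y + x) * complex_of_real (\<omega> (y + x) / (\<omega> x * \<omega> y))) =
        norm (g (y + x)) * (\<omega> (y + x) / (\<omega> x * \<omega> y))"
      using r0 by (simp only: norm_mult norm_of_real abs_of_nonneg)
    also have "\<dots> \<le> norm (g (y + x)) * 1" by (rule mult_left_mono[OF r1]) simp
    finally show ?thesis using B[of "y + x"] by linarith
  qed
  then show ?thesis using c unfolding bcontfun_def eq by (auto simp: bounded_iff)
qed

lemma cscale_in_bcontfun:
  "(\<lambda>y. c * apply_bcontfun g y) \<in> bcontfun" for g :: "'a::topological_space \<Rightarrow>\<^sub>C complex"
proof -
  have "bounded ((\<lambda>z. c * z) ` range (apply_bcontfun g))"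
    by (rule bounded_linear_image[OF bounded_apply_bcontfun bounded_linear_mult_right])
  then show ?thesis by (auto simp: bcontfun_def image_image intro!: continuous_intros)
qed

lemma topspace_weak_topology_Cb [simp]:
  "topspace (weak_topology_Cb :: ('a::topological_space \<Rightarrow>\<^sub>C complex) topology) = UNIV"
proof -
  have "(\<lambda>_. 0) \<in> (Cb_dual :: (('a \<Rightarrow>\<^sub>C complex) \<Rightarrow> complex) set)"
    by (simp add: Cb_dual_def bounded_linear_zero)
  then have "UNIV \<in> {\<phi> -` U | \<phi> U. \<phi> \<in> (Cb_dual :: (('a \<Rightarrow>\<^sub>C complex) \<Rightarrow> complex) set) \<and> open U}"
    by (intro CollectI exI[of _ "\<lambda>_. 0"] exI[of _ UNIV]) auto
  then show ?thesis unfolding weak_topology_Cb_def topology_generated_by_topspace by blast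
qed

lemma Omega_vanishes_imp_compact:
  fixes \<omega> :: "'a::topological_group_add \<Rightarrow> real"
  assumes w: "weight \<omega>"
    and v: "\<forall>\<epsilon>>0. \<exists>K. compact K \<and> (\<forall>p. p \<notin> K \<longrightarrow> norm (Omega \<omega> p) < \<epsilon>)"
  shows "compact (UNIV :: 'a set)"
proof -
  obtain K :: "('a \<times> 'a) set" where K: "compact K" "\<And>p. p \<notin> K \<Longrightarrow> norm (Omega \<omega> p) < 1"
    using v zero_less_one by blast
  have "(0, y) \<in> K" for y
  proof (rule ccontr)
    assume "(0, y) \<notin> K"
    moreover have "\<omega> 0 = 1" "1 \<le> \<omega> y" using w by (auto simp: weight_def)
    ultimately show False using K(2)[of "(0, y)"] by (simp add: Omega_def)
  qed
  then have "snd ` K = UNIV" by force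
  moreover have "compact (snd ` K)"
    by (rule compact_continuous_image[OF continuous_on_snd[OF continuous_on_id] K(1)])
  ultimately show ?thesis by simp
qed

end

theory Submission
  imports Defs
begin

text \<open>Write \<open>g = f / \<omega>\<close>; the weighted translate by \<open>x\<close> is then \<open>y \<mapsto> g (y + x) \<Omega>(y, x)\<close>.
  On compact sets of first arguments \<open>\<Omega>\<close> is bounded below, so a zero cluster \<open>\<Omega>\<close> forces the
  group to be discrete. Then the weak compactness of the translates is obtained without Grothendieck's
  double limit criterion: every functional on the bounded functions is the sum of an absolutely convergent
  series of point evaluations and of a diffuse functional, which kills finitely supported functions.
  The first summand is continuous for pointwise convergence on bounded sets. The diffuse one takes
  values \<open>\<ge> \<delta>\<close> on only finitely many translates, since otherwise a finitely additive
  intersection argument yields injective sequences with \<open>\<Omega>(u k, v n) \<ge> \<epsilon>\<close> for \<open>n \<le> k\<close>. Hence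
  pointwise and weak topology agree on the pointwise closure of the translates, which is compact by
  Tychonoff. Conversely, in a discrete group the double limit property for \<open>g\<close> the indicator of
  \<open>{u i + v j | i < j}\<close> or its complement, along subsequences for which these sums avoid those
  with \<open>i > j\<close>, makes the iterated limits of \<open>\<Omega>\<close> vanish. In the almost periodic case
  the choice \<open>f = \<omega>\<close> suffices for necessity, and total boundedness gives sufficiency.\<close>

section \<open>Sequences, iterated limits and discrete spaces\<close>

text \<open>Recursive choice along the finite sets of values chosen so far. The invariant
  \<open>Q\<close> carries whatever guarantees a next choice, and \<open>P\<close> may speak of all
  earlier values, in particular to keep the sequence injective.\<close>

lemma exists_seq_with_invariant:
  assumes Q0: "Q {}"
    and step: "\<And>E. finite E \<Longrightarrow> Q E \<Longrightarrow> \<exists>v. P E v \<and> Q (insert v E)"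
  obtains v :: "nat \<Rightarrow> 'b" where "\<And>n. Q (v ` {..<n})" and "\<And>n. P (v ` {..<n}) (v n)"
proof -
  define pick where "pick E = (SOME v. P E v \<and> Q (insert v E))" for E
  have pick: "P E (pick E) \<and> Q (insert (pick E) E)" if "finite E" "Q E" for E
    unfolding pick_def using step[OF that] by (rule someI_ex)
  define E where "E = rec_nat {} (\<lambda>_ E. insert (pick E) E)"
  have E0: "E 0 = {}" and ES: "E (Suc n) = insert (pick (E n)) (E n)" for n
    by (simp_all add: E_def)
  have E: "E n = (\<lambda>n. pick (E n)) ` {..<n} \<and> Q (E n)" for n
  proof (induction n)
    case 0
    show ?case using Q0 by (simp add: E0)
  next
    case (Suc n)
    then have fin: "finite (E n)" by (metis finite_imageI finite_lessThan)
    have "Q (E (Suc n))" using pick[OF fin] Suc by (metis ES)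
    moreover have "E (Suc n) = (\<lambda>n. pick (E n)) ` {..<Suc n}"
      using Suc by (simp add: ES lessThan_Suc)
    ultimately show ?case by blast
  qed
  show thesis
  proof (rule that[of "\<lambda>n. pick (E n)"])
    fix n
    have fin: "finite (E n)" using E by (metis finite_imageI finite_lessThan)
    show "Q ((\<lambda>n. pick (E n)) ` {..<n})" using E by metis
    show "P ((\<lambda>n. pick (E n)) ` {..<n}) (pick (E n))" using E pick[OF fin] by metis
  qed
qed

lemma exists_seq_avoiding:
  fixes P :: "'b set \<Rightarrow> 'b \<Rightarrow> bool"
  assumes "\<And>E. finite E \<Longrightarrow> \<exists>v. P E v"
  shows "\<exists>v :: nat \<Rightarrow> 'b. \<forall>n. P (v ` {..<n}) (v n)"
  using exists_seq_with_invariant[of "\<lambda>_. True" P] assms by metis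

lemma inj_if_avoiding:
  fixes v :: "nat \<Rightarrow> 'b"
  assumes "\<And>n. v n \<notin> v ` {..<n}"
  shows "inj v"
proof (rule linorder_injI)
  fix i j :: nat assume "i < j"
  then show "v i \<noteq> v j" using assms[of j] by (metis imageI lessThan_iff)
qed

text \<open>In place of a diagonal argument: the columns \<open>\<lambda>n. F n m\<close> lie in a
  countable product of closed discs, which is compact and, being first countable, sequentially
  compact.\<close>

lemma pointwise_convergent_subseq:
  fixes F :: "nat \<Rightarrow> nat \<Rightarrow> complex"
  assumes "\<And>n m. norm (F n m) \<le> B"
  obtains r L where "strict_mono r" "\<And>n. (\<lambda>m. F n (r m)) \<longlonglongrightarrow> L n"
proof -
  let ?K = "PiE UNIV (\<lambda>_. cball 0 B) :: (nat \<Rightarrow> complex) set"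
  have "compactin (product_topology (\<lambda>_. euclidean) UNIV) ?K"
    by (simp add: compactin_PiE)
  then have "compact ?K" by (simp add: euclidean_product_topology)
  then have "seq_compact ?K" by (rule compact_imp_seq_compact)
  then obtain L r where r: "strict_mono r" and L: "((\<lambda>m n. F n m) \<circ> r) \<longlonglongrightarrow> L"
    by (rule seq_compactE[of _ "\<lambda>m n. F n m"]) (use assms in auto)
  have "(\<lambda>m. F n (r m)) \<longlonglongrightarrow> L n" for n
  proof -
    have "continuous_on UNIV (\<lambda>x::nat \<Rightarrow> complex. x n)"
      by (rule continuous_on_product_coordinates)
    then have "isCont (\<lambda>x::nat \<Rightarrow> complex. x n) L"
      unfolding continuous_on_eq_continuous_at[OF open_UNIV] by blast
    from isCont_tendsto_compose[OF this L] show ?thesis by (simp add: o_def)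
  qed
  with r that show thesis by blast
qed

text \<open>Inner limits in both orders are extracted first, then the outer limits. The earlier
  extractions survive because inner limits are unaffected by passing to subsequences of either
  index.\<close>

lemma iterated_limits_subseq:
  fixes F :: "nat \<Rightarrow> nat \<Rightarrow> complex"
  assumes B: "\<And>n m. norm (F n m) \<le> B"
  obtains r s a b where "strict_mono r" "strict_mono s"
    "iterated_limit (\<lambda>n m. F (r n) (s m)) a" "iterated_limit (\<lambda>m n. F (r n) (s m)) b"
proof -
  obtain s1 L where s1: "strict_mono s1" and L: "\<And>n. (\<lambda>m. F n (s1 m)) \<longlonglongrightarrow> L n"
    using pointwise_convergent_subseq[of F B, OF B] by metis
  obtain r1 L' where r1: "strict_mono r1" and L': "\<And>m. (\<lambda>n. F (r1 n) (s1 m)) \<longlonglongrightarrow> L' m"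
    using pointwise_convergent_subseq[of "\<lambda>m n. F n (s1 m)" B, OF B] by metis
  have "norm (L n) \<le> B" for n
    by (rule LIMSEQ_le_const2[OF tendsto_norm[OF L]]) (use B in auto)
  \<comment> \<open>The single bounded sequence is passed as a double one that is constant in its
    first index.\<close>
  then obtain r2 a where r2: "strict_mono r2" and a: "(\<lambda>n. L (r1 (r2 n))) \<longlonglongrightarrow> a"
    using pointwise_convergent_subseq[of "\<lambda>_ n. L (r1 n)" B] by metis
  have "norm (L' m) \<le> B" for m
    by (rule LIMSEQ_le_const2[OF tendsto_norm[OF L']]) (use B in auto)
  then obtain s2 b where s2: "strict_mono s2" and b: "(\<lambda>m. L' (s2 m)) \<longlonglongrightarrow> b"
    using pointwise_convergent_subseq[of "\<lambda>_ m. L' m" B] by metis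
  show thesis
  proof (rule that)
    show "strict_mono (r1 \<circ> r2)" "strict_mono (s1 \<circ> s2)"
      using r1 r2 s1 s2 by (auto simp: strict_mono_o)
    show "iterated_limit (\<lambda>n m. F ((r1 \<circ> r2) n) ((s1 \<circ> s2) m)) a"
      unfolding iterated_limit_def
      using a LIMSEQ_subseq_LIMSEQ[OF L s2] by (auto simp: o_def intro!: exI[of _ "\<lambda>n. L (r1 (r2 n))"])
    show "iterated_limit (\<lambda>m n. F ((r1 \<circ> r2) n) ((s1 \<circ> s2) m)) b"
      unfolding iterated_limit_def
      using b LIMSEQ_subseq_LIMSEQ[OF L' r2] by (auto simp: o_def intro!: exI[of _ "\<lambda>m. L' (s2 m)"])
  qed
qed

lemma iterated_limit_norm_ge:
  assumes "iterated_limit F l" "\<And>n. eventually (\<lambda>m. \<epsilon> \<le> norm (F n m)) sequentially"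
  shows "\<epsilon> \<le> norm l"
proof -
  obtain L where L: "\<And>n. F n \<longlonglongrightarrow> L n" "L \<longlonglongrightarrow> l"
    using assms(1) by (auto simp: iterated_limit_def)
  have "\<epsilon> \<le> norm (L n)" for n
    by (rule tendsto_lowerbound[OF tendsto_norm[OF L(1)] assms(2)]) simp
  then show ?thesis
    by (intro tendsto_lowerbound[OF tendsto_norm[OF L(2)]]) auto
qed

text \<open>The form in which zero cluster is contradicted later. Along subsequences both iterated
  limits exist since \<open>F\<close> is bounded; they vanish by hypothesis, while a lower bound
  holding eventually in the inner index persists in the limit. The two conclusions serve the two
  orders of limits.\<close>

lemma zero_cluster_no_grid:
  fixes F :: "'a \<times> 'a \<Rightarrow> complex"
  assumes zc: "zero_cluster F" and B: "\<And>p. norm (F p) \<le> B" and "\<epsilon> > 0"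
    and uv: "inj u" "inj v"
  shows "\<not> (\<forall>n. eventually (\<lambda>m. \<epsilon> \<le> norm (F (u n, v m))) sequentially)"
    and "\<not> (\<forall>m. eventually (\<lambda>n. \<epsilon> \<le> norm (F (u n, v m))) sequentially)"
proof -
  obtain r s a b where rs: "strict_mono r" "strict_mono s" and
    ab: "iterated_limit (\<lambda>n m. F (u (r n), v (s m))) a" "iterated_limit (\<lambda>m n. F (u (r n), v (s m))) b"
    using iterated_limits_subseq[of "\<lambda>n m. F (u n, v m)"] B by blast
  have "inj (u \<circ> r)" "inj (v \<circ> s)"
    using rs uv by (auto intro!: inj_compose strict_mono_imp_inj_on)
  with ab zc have 0: "a = 0" "b = 0"
    unfolding zero_cluster_def by (auto simp: o_def)
  show "\<not> (\<forall>n. eventually (\<lambda>m. \<epsilon> \<le> norm (F (u n, v m))) sequentially)"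
  proof
    assume "\<forall>n. eventually (\<lambda>m. \<epsilon> \<le> norm (F (u n, v m))) sequentially"
    then have "eventually (\<lambda>m. \<epsilon> \<le> norm (F (u (r n), v (s m)))) sequentially" for n
      using eventually_subseq[OF rs(2)] by blast
    from iterated_limit_norm_ge[OF ab(1) this] show False using 0 \<open>\<epsilon> > 0\<close> by simp
  qed
  show "\<not> (\<forall>m. eventually (\<lambda>n. \<epsilon> \<le> norm (F (u n, v m))) sequentially)"
  proof
    assume "\<forall>m. eventually (\<lambda>n. \<epsilon> \<le> norm (F (u n, v m))) sequentially"
    then have "eventually (\<lambda>n. \<epsilon> \<le> norm (F (u (r n), v (s m)))) sequentially" for m
      using eventually_subseq[OF rs(1)] by blast
    from iterated_limit_norm_ge[OF ab(2) this] show False using 0 \<open>\<epsilon> > 0\<close> by simp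
  qed
qed

section \<open>Discrete spaces and discrete groups\<close>

lemma discrete_UNIV_open:
  fixes S :: "'a::topological_space set"
  assumes "discrete (UNIV :: 'a set)"
  shows "open S"
proof -
  have "open {x}" for x :: 'a using assms by (auto simp: discrete_def isolated_in_def)
  then have "open (\<Union>x\<in>S. {x})" by blast
  then show ?thesis by simp
qed

lemma discrete_UNIV_continuous_on:
  fixes f :: "'a::topological_space \<Rightarrow> 'b::topological_space"
  assumes "discrete (UNIV :: 'a set)"
  shows "continuous_on S f"
  unfolding continuous_on_open_vimage[OF discrete_UNIV_open[OF assms]]
  using discrete_UNIV_open[OF assms] by (metis continuous_on_open_invariant)

lemma discrete_UNIV_compact_iff:
  fixes S :: "'a::topological_space set"
  assumes "discrete (UNIV :: 'a set)"
  shows "compact S \<longleftrightarrow> finite S"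
proof
  assume c: "compact S"
  obtain D where "D \<subseteq> (\<lambda>x. {x}) ` S" "finite D" "S \<subseteq> \<Union>D"
    by (rule compactE[OF c, of "(\<lambda>x. {x}) ` S"]) (auto simp: discrete_UNIV_open[OF assms])
  moreover have "finite (\<Union>D)" using calculation(1,2) by (intro finite_Union) auto
  ultimately show "finite S" by (rule_tac finite_subset)
qed (rule finite_imp_compact)

lemma discrete_UNIV_if_open_singleton:
  fixes a :: "'a::topological_group_add"
  assumes "open {a}"
  shows "discrete (UNIV :: 'a set)"
proof (rule discreteI)
  fix x :: 'a
  have "continuous_on UNIV (\<lambda>y. a - x + y)" by (intro continuous_intros)
  then have "open ((\<lambda>y. a - x + y) -` {a})" using assms by (rule open_vimage[rotated])
  moreover have "(\<lambda>y. a - x + y) -` {a} = {x}"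
  proof -
    have "a - x + y = a \<longleftrightarrow> y = x" for y
      by (metis add.assoc add_left_cancel diff_add_cancel)
    then show ?thesis by auto
  qed
  ultimately show "x isolated_in UNIV" by (auto simp: isolated_in_def)
qed

section \<open>Weights and the weak topology\<close>

lemma weight_pos: "weight \<omega> \<Longrightarrow> 0 < \<omega> x"
  unfolding weight_def using less_le_trans[OF zero_less_one] by blast

lemma norm_Omega:
  assumes "weight \<omega>"
  shows "norm (Omega \<omega> (x, y)) = \<omega> (x + y) / (\<omega> x * \<omega> y)"
  using weight_pos[OF assms, of x] weight_pos[OF assms, of y] weight_pos[OF assms, of "x + y"]
  by (simp add: Omega_def norm_divide norm_mult)

lemma norm_Omega_le_1:
  assumes "weight \<omega>"
  shows "norm (Omega \<omega> p) \<le> 1"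
proof (cases p)
  case (Pair x y)
  have "\<omega> (x + y) \<le> \<omega> x * \<omega> y" using assms by (auto simp: weight_def)
  then show ?thesis
    using weight_pos[OF assms, of x] weight_pos[OF assms, of y]
    by (simp add: Pair norm_Omega[OF assms] divide_le_eq_1)
qed

text \<open>Submultiplicativity applied to \<open>y = - x + (x + y)\<close>. The lower bound
  involves \<open>x\<close> alone.\<close>

lemma norm_Omega_ge:
  fixes \<omega> :: "'a::topological_group_add \<Rightarrow> real"
  assumes "weight \<omega>"
  shows "1 / (\<omega> (- x) * \<omega> x) \<le> norm (Omega \<omega> (x, y))"
proof -
  have "\<omega> (- x + (x + y)) \<le> \<omega> (- x) * \<omega> (x + y)" using assms unfolding weight_def by blast
  then have "\<omega> y \<le> \<omega> (- x) * \<omega> (x + y)" by (simp add: add.assoc[symmetric])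
  then show ?thesis
    using weight_pos[OF assms, of x] weight_pos[OF assms, of y] weight_pos[OF assms, of "- x"]
    by (simp add: norm_Omega[OF assms] field_simps)
qed

lemma Cb_weighted_bound:
  assumes "f \<in> Cb_weighted \<omega>"
  obtains B where "0 < B" "\<And>x. norm (f x / complex_of_real (\<omega> x)) \<le> B"
  using assms by (auto simp: Cb_weighted_def bcontfun_def bounded_pos)

lemma Cb_weighted_continuous_on:
  assumes w: "weight \<omega>" and f: "f \<in> Cb_weighted \<omega>"
  shows "continuous_on S f"
proof -
  have "continuous_on UNIV (\<lambda>x. f x / complex_of_real (\<omega> x))"
    using f by (simp add: Cb_weighted_def bcontfun_def)
  moreover have "continuous_on UNIV (\<lambda>x. complex_of_real (\<omega> x))"
    using w by (intro continuous_intros) (simp add: weight_def)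
  ultimately have "continuous_on UNIV (\<lambda>x. f x / complex_of_real (\<omega> x) * complex_of_real (\<omega> x))"
    by (rule continuous_on_mult)
  moreover have "f x / complex_of_real (\<omega> x) * complex_of_real (\<omega> x) = f x" for x
    using weight_pos[OF w, of x] by simp
  ultimately show ?thesis by (metis (no_types, lifting) continuous_on_cong continuous_on_subset subset_UNIV)
qed

lemma apply_weighted_translate:
  assumes w: "weight \<omega>" and f: "f \<in> Cb_weighted \<omega>"
  shows "apply_bcontfun (weighted_translate \<omega> f x) y = f (y + x) / complex_of_real (\<omega> x * \<omega> y)"
  unfolding weighted_translate_def
  by (subst Bcontfun_inverse[OF weighted_translate_in_bcontfun[OF w f]]) simp

lemma apply_weighted_translate_Omega:
  assumes w: "weight \<omega>" and f: "f \<in> Cb_weighted \<omega>"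
  shows "apply_bcontfun (weighted_translate \<omega> f x) y
           = f (y + x) / complex_of_real (\<omega> (y + x)) * Omega \<omega> (y, x)"
  using weight_pos[OF w, of "y + x"]
  by (simp add: apply_weighted_translate[OF w f] Omega_def)

lemma norm_weighted_translate_le:
  assumes w: "weight \<omega>" and f: "f \<in> Cb_weighted \<omega>"
    and B: "\<And>x. norm (f x / complex_of_real (\<omega> x)) \<le> B"
  shows "norm (apply_bcontfun (weighted_translate \<omega> f x) y) \<le> B * norm (Omega \<omega> (y, x))"
  unfolding apply_weighted_translate_Omega[OF w f] norm_mult
  using B by (rule mult_right_mono) simp

text \<open>Point evaluations separate points, which makes the weak topology Hausdorff, and they
  determine the values of a weak cluster point.\<close>

lemma eval_in_Cb_dual: "(\<lambda>g. apply_bcontfun g y) \<in> Cb_dual"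
proof -
  have "bounded_linear (\<lambda>g :: 'a \<Rightarrow>\<^sub>C complex. apply_bcontfun g y)"
    by (rule bounded_linear_intro[of _ 1]) (simp_all add: norm_bounded)
  then show ?thesis by (simp add: Cb_dual_def Bcontfun_inverse[OF cscale_in_bcontfun])
qed

section \<open>The weak topology: continuity, compactness and cluster points\<close>

lemma openin_weak_topology_Cb:
  "\<phi> \<in> Cb_dual \<Longrightarrow> open U \<Longrightarrow> openin weak_topology_Cb (\<phi> -` U)"
  unfolding weak_topology_Cb_def by (rule topology_generated_by_Basis) blast

text \<open>The universal property of an initial topology.\<close>

lemma continuous_map_weak_topology_Cb:
  fixes f :: "'b \<Rightarrow> ('a::topological_space \<Rightarrow>\<^sub>C complex)"
  assumes "\<And>\<phi>. \<phi> \<in> Cb_dual \<Longrightarrow> continuous_map X euclidean (\<lambda>x. \<phi> (f x))"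
  shows "continuous_map X weak_topology_Cb f"
  unfolding weak_topology_Cb_def continuous_on_generated_topo_iff
proof (intro conjI allI impI)
  fix V :: "('a \<Rightarrow>\<^sub>C complex) set" assume "V \<in> {\<phi> -` U |\<phi> U. \<phi> \<in> Cb_dual \<and> open U}"
  then obtain \<phi> U where V: "V = \<phi> -` U" "\<phi> \<in> Cb_dual" "open U" by blast
  have "openin X {x \<in> topspace X. \<phi> (f x) \<in> U}"
    using openin_continuous_map_preimage[OF assms[OF V(2)]] V(3) by auto
  moreover have "{x \<in> topspace X. \<phi> (f x) \<in> U} = f -` V \<inter> topspace X" using V(1) by auto
  ultimately show "openin X (f -` V \<inter> topspace X)" by simp
next
  have "\<Union> {\<phi> -` U |\<phi> U. \<phi> \<in> (Cb_dual :: (('a \<Rightarrow>\<^sub>C complex) \<Rightarrow> complex) set) \<and> open U} = UNIV"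
    using topspace_weak_topology_Cb[where 'a='a]
    unfolding weak_topology_Cb_def topology_generated_by_topspace .
  then show "f ` topspace X \<subseteq> \<Union> {\<phi> -` U |\<phi> U. \<phi> \<in> Cb_dual \<and> open U}"
    by simp
qed

lemma Hausdorff_weak_topology_Cb:
  "Hausdorff_space (weak_topology_Cb :: ('a::topological_space \<Rightarrow>\<^sub>C complex) topology)"
  unfolding Hausdorff_space_def
proof clarify
  fix g h :: "'a \<Rightarrow>\<^sub>C complex" assume "g \<noteq> h"
  then obtain y where "apply_bcontfun g y \<noteq> apply_bcontfun h y" using bcontfun_eqI by blast
  then obtain U V where UV: "open U" "open V" "apply_bcontfun g y \<in> U" "apply_bcontfun h y \<in> V"
    "U \<inter> V = {}" using hausdorff by metis
  show "\<exists>U V. openin weak_topology_Cb U \<and> openin weak_topology_Cb V \<and> g \<in> U \<and> h \<in> V \<and> disjnt U V"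
    by (rule exI[of _ "(\<lambda>g. apply_bcontfun g y) -` U"], rule exI[of _ "(\<lambda>g. apply_bcontfun g y) -` V"])
      (use UV in \<open>auto simp: disjnt_def intro!: openin_weak_topology_Cb eval_in_Cb_dual\<close>)
qed

text \<open>The weak topology is Hausdorff, so \<open>K\<close> is weakly closed and contains the
  weak closure of \<open>A\<close>. Relative weak compactness can thus be shown by exhibiting any
  weakly compact superset.\<close>

lemma compactin_weak_closure:
  assumes "compactin weak_topology_Cb K" "A \<subseteq> K"
  shows "compactin weak_topology_Cb (weak_topology_Cb closure_of A)"
proof -
  have "closedin weak_topology_Cb K"
    using Hausdorff_weak_topology_Cb assms(1) by (rule compactin_imp_closedin)
  then have "weak_topology_Cb closure_of A \<subseteq> K" using assms(2) by (rule closure_of_minimal[rotated])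
  then show ?thesis using closed_compactin[OF assms(1)] by simp
qed

text \<open>The identity from the norm topology to the weak topology is continuous, so norm compact
  sets are weakly compact.\<close>

lemma Ap_subset_Wap: "Ap \<omega> \<subseteq> Wap \<omega>"
proof
  fix f assume f: "f \<in> Ap \<omega>"
  have "continuous_map euclidean weak_topology_Cb (\<lambda>g :: 'a \<Rightarrow>\<^sub>C complex. g)"
    by (rule continuous_map_weak_topology_Cb)
      (auto simp: Cb_dual_def intro: linear_continuous_on)
  from image_compactin[OF _ this, of "closure (range (weighted_translate \<omega> f))"]
  have "compactin weak_topology_Cb (closure (range (weighted_translate \<omega> f)))"
    using f by (auto simp: Ap_def)
  from compactin_weak_closure[OF this closure_subset] show "f \<in> Wap \<omega>"
    using f by (auto simp: Ap_def Wap_def)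
qed

lemma Wap_subset_Cb_weighted: "Wap \<omega> \<subseteq> Cb_weighted \<omega>"
  by (auto simp: Wap_def)

text \<open>Finite intersection property of the weak closures of the tails. Since no convergent
  subsequence is extracted, the conclusion is stated with \<open>frequently\<close>.\<close>

lemma weak_cluster_point:
  fixes s :: "nat \<Rightarrow> ('a::topological_space \<Rightarrow>\<^sub>C complex)"
  assumes K: "compactin weak_topology_Cb K" and s: "\<And>n. s n \<in> K"
  obtains h where
    "\<And>\<phi> U. \<phi> \<in> Cb_dual \<Longrightarrow> open U \<Longrightarrow> \<phi> h \<in> U \<Longrightarrow> frequently (\<lambda>n. \<phi> (s n) \<in> U) sequentially"
proof -
  define \<U> where "\<U> = (\<lambda>N. weak_topology_Cb closure_of (s ` {N..})) ` UNIV"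
  have "K \<inter> \<Inter>\<F> \<noteq> {}" if \<F>: "finite \<F>" "\<F> \<subseteq> \<U>" for \<F>
  proof -
    obtain M where M: "finite M" "\<F> = (\<lambda>N. weak_topology_Cb closure_of (s ` {N..})) ` M"
      using finite_subset_image[OF \<F>[unfolded \<U>_def]] by blast
    obtain k where k: "\<forall>N\<in>M. N \<le> k" using M(1) finite_nat_set_iff_bounded_le by blast
    have "s k \<in> weak_topology_Cb closure_of (s ` {N..})" if "N \<in> M" for N
      using closure_of_subset[of "s ` {N..}" weak_topology_Cb] k that by auto
    then have "s k \<in> K \<inter> \<Inter>\<F>" using s M(2) by blast
    then show ?thesis by blast
  qed
  moreover have "\<forall>C\<in>\<U>. closedin weak_topology_Cb C" by (auto simp: \<U>_def)
  ultimately have "K \<inter> \<Inter>\<U> \<noteq> {}" using K unfolding compactin_fip by blast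
  then obtain h where h: "\<And>N. h \<in> weak_topology_Cb closure_of (s ` {N..})" by (auto simp: \<U>_def)
  show thesis
  proof (rule that[of h])
    fix \<phi> :: "('a \<Rightarrow>\<^sub>C complex) \<Rightarrow> complex" and U
    assume \<phi>: "\<phi> \<in> Cb_dual" and U: "open U" "\<phi> h \<in> U"
    show "frequently (\<lambda>n. \<phi> (s n) \<in> U) sequentially"
      unfolding frequently_sequentially
    proof
      fix N
      show "\<exists>n\<ge>N. \<phi> (s n) \<in> U"
        using h[of N] openin_weak_topology_Cb[OF \<phi> U(1)] U(2) by (auto simp: in_closure_of)
    qed
  qed
qed

text \<open>Identifies a cluster value with the limit as soon as the scalar sequence in question
  converges.\<close>

lemma frequently_tendsto_eq:
  fixes l l' :: "'b::t2_space"
  assumes "\<And>U. open U \<Longrightarrow> l \<in> U \<Longrightarrow> frequently (\<lambda>n. x n \<in> U) F" and "(x \<longlongrightarrow> l') F"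
  shows "l = l'"
proof (rule ccontr)
  assume "l \<noteq> l'"
  then obtain U V where UV: "open U" "open V" "l \<in> U" "l' \<in> V" "U \<inter> V = {}" using hausdorff by metis
  have "eventually (\<lambda>n. x n \<in> V) F" using assms(2) UV by (auto simp: tendsto_def)
  with assms(1)[OF UV(1,3)] have "frequently (\<lambda>n. x n \<in> V \<and> x n \<in> U) F"
    by (rule frequently_eventually_conj)
  then show False using UV(5) frequently_ex by fastforce
qed

text \<open>A generalised limit along \<open>u\<close>, found as in the Banach-Alaoglu theorem: the
  evaluations at the points \<open>u n\<close> lie in the product of the discs of radius
  \<open>norm g\<close>, which is compact, and any cluster point of them inherits linearity and
  boundedness.\<close>

lemma limit_functional:
  fixes u :: "nat \<Rightarrow> 'a::topological_space"
  obtains \<phi> where "\<phi> \<in> Cb_dual"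
    "\<And>g l. (\<lambda>n. apply_bcontfun g (u n)) \<longlonglongrightarrow> l \<Longrightarrow> \<phi> g = l"
proof -
  define p where "p n = (\<lambda>g :: 'a \<Rightarrow>\<^sub>C complex. apply_bcontfun g (u n))" for n
  define K where "K = (PiE UNIV (\<lambda>g. cball 0 (norm g)) :: (('a \<Rightarrow>\<^sub>C complex) \<Rightarrow> complex) set)"
  have "compactin (product_topology (\<lambda>_. euclidean) UNIV) K"
    by (simp add: compactin_PiE K_def)
  then have "compact K" by (simp add: euclidean_product_topology)
  moreover have "eventually (\<lambda>\<psi>. \<psi> \<in> K) (filtermap p sequentially)"
    by (auto simp: eventually_filtermap K_def p_def PiE_iff norm_bounded)
  moreover have "filtermap p sequentially \<noteq> bot" by (simp add: filtermap_bot_iff)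
  ultimately obtain \<phi> where \<phi>: "\<phi> \<in> K" "inf (nhds \<phi>) (filtermap p sequentially) \<noteq> bot"
    unfolding compact_filter by blast
  \<comment> \<open>A filter finer than the image of \<open>sequentially\<close> and converging
    pointwise to \<phi>. Identities satisfied by every \<open>p n\<close> therefore pass to \<phi>,
    and so do limits along \<open>u\<close>.\<close>
  define H where "H = inf (nhds \<phi>) (filtermap p sequentially)"
  have H: "H \<noteq> bot" "H \<le> nhds \<phi>" "H \<le> filtermap p sequentially" using \<phi>(2) by (simp_all add: H_def)
  have lim: "((\<lambda>\<psi>. \<psi> g) \<longlongrightarrow> \<phi> g) H" for g
  proof -
    have "continuous_on UNIV (\<lambda>\<psi>::('a \<Rightarrow>\<^sub>C complex) \<Rightarrow> complex. \<psi> g)"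
      by (rule continuous_on_product_coordinates)
    then have "open ((\<lambda>\<psi>::('a \<Rightarrow>\<^sub>C complex) \<Rightarrow> complex. \<psi> g) -` S)" if "open S" for S
      by (rule open_vimage[OF that])
    then have "((\<lambda>\<psi>. \<psi> g) \<longlongrightarrow> \<phi> g) (nhds \<phi>)"
      by (intro topological_tendstoI) (auto simp: eventually_nhds)
    then show ?thesis using H(2) by (rule tendsto_mono[rotated])
  qed
  have ev: "eventually P H" if "\<And>n. P (p n)" for P
    using H(3) that by (auto simp: le_filter_def eventually_filtermap)
  have add: "\<phi> (g + h) = \<phi> g + \<phi> h" for g h
  proof -
    have "((\<lambda>\<psi>. \<psi> (g + h)) \<longlongrightarrow> \<phi> g + \<phi> h) H"
      using tendsto_add[OF lim[of g] lim[of h]]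
      by (rule Lim_transform_eventually) (rule ev, simp add: p_def)
    with lim H(1) show ?thesis by (metis tendsto_unique)
  qed
  have scale: "\<phi> (Bcontfun (\<lambda>y. c * apply_bcontfun g y)) = c * \<phi> g" for c g
  proof -
    have "((\<lambda>\<psi>. \<psi> (Bcontfun (\<lambda>y. c * apply_bcontfun g y))) \<longlongrightarrow> c * \<phi> g) H"
      using tendsto_mult_left[OF lim[of g], of c]
      by (rule Lim_transform_eventually) (rule ev, simp add: p_def Bcontfun_inverse[OF cscale_in_bcontfun])
    with lim H(1) show ?thesis by (metis tendsto_unique)
  qed
  have scaleR: "\<phi> (r *\<^sub>R g) = r *\<^sub>R \<phi> g" for r g
  proof -
    have "r *\<^sub>R g = Bcontfun (\<lambda>y. complex_of_real r * apply_bcontfun g y)"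
      by (rule bcontfun_eqI) (simp add: Bcontfun_inverse[OF cscale_in_bcontfun] scaleR_conv_of_real)
    then show ?thesis using scale by (simp add: scaleR_conv_of_real)
  qed
  have bnd: "norm (\<phi> g) \<le> norm g * 1" for g using \<phi>(1) by (auto simp: K_def PiE_iff)
  show thesis
  proof (rule that[of \<phi>])
    show "\<phi> \<in> Cb_dual"
      using bounded_linear_intro[OF add scaleR bnd] scale by (simp add: Cb_dual_def)
    fix g :: "'a \<Rightarrow>\<^sub>C complex" and l assume "(\<lambda>n. apply_bcontfun g (u n)) \<longlonglongrightarrow> l"
    then have "((\<lambda>\<psi>. \<psi> g) \<longlongrightarrow> l) (filtermap p sequentially)" by (simp add: filterlim_filtermap p_def)
    then have "((\<lambda>\<psi>. \<psi> g) \<longlongrightarrow> l) H" using H(3) by (rule tendsto_mono[rotated])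
    with lim H(1) show "\<phi> g = l" by (metis tendsto_unique)
  qed
qed

text \<open>The easy half of the double limit criterion. Let \<open>h\<close> be a weak cluster
  point of the translates by \<open>v m\<close>, and \<phi> a generalised limit along
  \<open>u\<close>. Computing \<open>\<phi> h\<close> from the values \<open>h (u n)\<close> gives
  \<open>a\<close>; computing it as a cluster value of \<phi> on the translates gives
  \<open>b\<close>.\<close>

lemma Wap_iterated_limits_eq:
  assumes f: "f \<in> Wap \<omega>"
    and a: "iterated_limit (\<lambda>n m. apply_bcontfun (weighted_translate \<omega> f (v m)) (u n)) a"
    and b: "iterated_limit (\<lambda>m n. apply_bcontfun (weighted_translate \<omega> f (v m)) (u n)) b"
  shows "a = b"
proof -
  define T where "T = weighted_translate \<omega> f"
  have "compactin weak_topology_Cb (weak_topology_Cb closure_of range T)"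
    using f by (simp add: Wap_def T_def)
  moreover have "T (v m) \<in> weak_topology_Cb closure_of range T" for m
    using closure_of_subset[of "range T" weak_topology_Cb] by auto
  ultimately obtain h where h: "\<And>\<phi> U. \<phi> \<in> Cb_dual \<Longrightarrow> open U \<Longrightarrow> \<phi> h \<in> U
      \<Longrightarrow> frequently (\<lambda>m. \<phi> (T (v m)) \<in> U) sequentially"
    using weak_cluster_point[of _ "\<lambda>m. T (v m)"] by metis
  obtain L where L: "\<And>n. (\<lambda>m. apply_bcontfun (T (v m)) (u n)) \<longlonglongrightarrow> L n" "L \<longlonglongrightarrow> a"
    using a by (auto simp: iterated_limit_def T_def)
  obtain L' where L': "\<And>m. (\<lambda>n. apply_bcontfun (T (v m)) (u n)) \<longlonglongrightarrow> L' m" "L' \<longlonglongrightarrow> b"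
    using b by (auto simp: iterated_limit_def T_def)
  obtain \<phi> where \<phi>: "\<phi> \<in> Cb_dual" "\<And>g l. (\<lambda>n. apply_bcontfun g (u n)) \<longlonglongrightarrow> l \<Longrightarrow> \<phi> g = l"
    using limit_functional[of u] by blast
  have "apply_bcontfun h (u n) = L n" for n
    by (rule frequently_tendsto_eq[OF h[OF eval_in_Cb_dual] L(1)])
  then have "\<phi> h = a" using \<phi>(2)[of h a] L(2) by simp
  moreover have "\<phi> (T (v m)) = L' m" for m using \<phi>(2)[OF L'(1)] .
  then have "\<phi> h = b" by (intro frequently_tendsto_eq[OF h[OF \<phi>(1)]]) (use L'(2) in auto)
  ultimately show ?thesis by simp
qed

section \<open>Compactness of sets of translates\<close>

lemma open_pointwise_near:
  fixes c :: "'a \<Rightarrow> complex"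
  assumes "finite K"
  shows "open {s. \<forall>y\<in>K. dist (s y) (c y) < e}"
proof -
  have "open (\<Inter>y\<in>K. (\<lambda>s::'a \<Rightarrow> complex. s y) -` ball (c y) e)"
    using assms by (intro open_INT ballI open_vimage open_ball continuous_on_product_coordinates)
  moreover have "(\<Inter>y\<in>K. (\<lambda>s::'a \<Rightarrow> complex. s y) -` ball (c y) e) = {s. \<forall>y\<in>K. dist (s y) (c y) < e}"
    by (auto simp: dist_commute)
  ultimately show ?thesis by simp
qed

lemma closed_singleton_fun: "closed {s :: 'a \<Rightarrow> complex}"
proof -
  have "closed (\<Inter>y. (\<lambda>z::'a \<Rightarrow> complex. z y) -` {s y})"
    by (intro closed_INT ballI closed_vimage closed_singleton continuous_on_product_coordinates)
  moreover have "(\<Inter>y. (\<lambda>z::'a \<Rightarrow> complex. z y) -` {s y}) = {s}" by auto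
  ultimately show ?thesis by simp
qed

text \<open>Tychonoff: a product of closed discs is compact and closed in the topology of pointwise
  convergence.\<close>

lemma compact_closure_uniformly_bounded:
  fixes A :: "('a \<Rightarrow> complex) set"
  assumes B: "\<And>s y. s \<in> A \<Longrightarrow> norm (s y) \<le> B"
  shows "compact (closure A)" and "\<And>s y. s \<in> closure A \<Longrightarrow> norm (s y) \<le> B"
proof -
  let ?K = "PiE UNIV (\<lambda>_. cball 0 B) :: ('a \<Rightarrow> complex) set"
  have "compactin (product_topology (\<lambda>_. euclidean) UNIV) ?K"
    "closedin (product_topology (\<lambda>_. euclidean) UNIV) ?K"
    by (simp_all add: compactin_PiE closedin_product_topology)
  then have K: "compact ?K" "closed ?K" by (simp_all add: euclidean_product_topology)
  have "A \<subseteq> ?K" using B by auto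
  then have sub: "closure A \<subseteq> ?K" using K(2) by (rule closure_minimal)
  then show "norm (s y) \<le> B" if "s \<in> closure A" for s y using that by (auto simp: PiE_iff)
  show "compact (closure A)"
    using compact_Int_closed[OF K(1) closed_closure[of A]] sub by (simp add: Int_absorb1)
qed

text \<open>Total boundedness on finitely many coordinates. As \<open>K\<close> is finite, being
  \<open>e\<close>-close on \<open>K\<close> is an open condition for pointwise convergence, and
  finitely many such neighbourhoods cover the compact closure.\<close>

lemma finite_pointwise_net:
  fixes t :: "'i \<Rightarrow> 'a \<Rightarrow> complex"
  assumes K: "finite K" and B: "\<And>x y. norm (t x y) \<le> B" and e: "e > 0"
  obtains N where "finite N" "N \<subseteq> X" "\<And>x. x \<in> X \<Longrightarrow> \<exists>x'\<in>N. \<forall>y\<in>K. dist (t x y) (t x' y) < e"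
proof -
  have c: "compact (closure (t ` X))"
    by (rule compact_closure_uniformly_bounded(1)) (use B in auto)
  have cover: "closure (t ` X) \<subseteq> (\<Union>x\<in>X. {s. \<forall>y\<in>K. dist (s y) (t x y) < e})"
  proof
    fix s assume "s \<in> closure (t ` X)"
    moreover have "s \<in> {z. \<forall>y\<in>K. dist (z y) (s y) < e}" using e by simp
    ultimately have "{z. \<forall>y\<in>K. dist (z y) (s y) < e} \<inter> t ` X \<noteq> {}"
      using open_Int_closure_eq_empty[OF open_pointwise_near[OF K, of s e], of "t ` X"] by blast
    then obtain x where "x \<in> X" "\<forall>y\<in>K. dist (t x y) (s y) < e" by blast
    then show "s \<in> (\<Union>x\<in>X. {s. \<forall>y\<in>K. dist (s y) (t x y) < e})" by (auto simp: dist_commute)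
  qed
  obtain N where N: "N \<subseteq> X" "finite N" "closure (t ` X) \<subseteq> (\<Union>x\<in>N. {s. \<forall>y\<in>K. dist (s y) (t x y) < e})"
    by (rule compactE_image[OF c open_pointwise_near[OF K] cover])
  show thesis
  proof (rule that[OF N(2,1)])
    fix x assume "x \<in> X"
    then have "t x \<in> closure (t ` X)" by (intro subsetD[OF closure_subset] imageI)
    then show "\<exists>x'\<in>N. \<forall>y\<in>K. dist (t x y) (t x' y) < e" using N(3) by blast
  qed
qed

text \<open>On a compact group the joint continuity of the translates in \<open>x\<close> and
  \<open>y\<close> is uniform in \<open>y\<close>, so \<open>x\<close> is sent norm continuously to
  its translate and the range is the image of a compact set.\<close>

lemma compact_imp_Ap:
  fixes \<omega> :: "'a::topological_group_add \<Rightarrow> real"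
  assumes w: "weight \<omega>" and f: "f \<in> Cb_weighted \<omega>" and c: "compact (UNIV :: 'a set)"
  shows "f \<in> Ap \<omega>"
proof -
  define T where "T = weighted_translate \<omega> f"
  have cf: "continuous_on UNIV f" by (rule Cb_weighted_continuous_on[OF w f])
  have cw: "continuous_on UNIV \<omega>" using w by (simp add: weight_def)
  have nz: "\<omega> x \<noteq> 0" for x using weight_pos[OF w, of x] by simp
  have "continuous_on (UNIV \<times> UNIV)
      (\<lambda>p. f (snd p + fst p) / complex_of_real (\<omega> (fst p) * \<omega> (snd p)))"
    by (intro continuous_intros continuous_on_compose2[OF cf] continuous_on_compose2[OF cw])
      (auto simp: nz)
  then have cT: "continuous_on (UNIV \<times> UNIV) (\<lambda>p. apply_bcontfun (T (fst p)) (snd p))"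
    by (simp add: T_def apply_weighted_translate[OF w f])
  have "(T \<longlongrightarrow> T x0) (at x0)" for x0
  proof (rule tendstoI)
    fix e :: real assume e: "e > 0"
    obtain X0 where X0: "x0 \<in> X0" "open X0" "\<forall>x\<in>X0 \<inter> UNIV. \<forall>y\<in>UNIV.
        dist (apply_bcontfun (T (fst (x, y))) (snd (x, y))) (apply_bcontfun (T (fst (x0, y))) (snd (x0, y))) \<le> e / 2"
      by (rule continuous_on_prod_compactE[OF cT c, of x0 "e / 2"]) (use e in auto)
    have "dist (T x) (T x0) < e" if "x \<in> X0" for x
    proof -
      have "dist (T x) (T x0) \<le> e / 2" by (rule dist_bound) (use X0(3) that in auto)
      then show ?thesis using e by simp
    qed
    then show "eventually (\<lambda>x. dist (T x) (T x0) < e) (at x0)"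
      using X0(1,2) by (auto simp: eventually_at_topological)
  qed
  then have "continuous_on UNIV T" by (simp add: continuous_on_def)
  from compact_continuous_image[OF this c] have "compact (range T)" .
  then show ?thesis using f by (simp add: Ap_def T_def closure_closed compact_imp_closed)
qed

lemma complete_UNIV_bcontfun:
  "complete (UNIV :: ('a::topological_space \<Rightarrow>\<^sub>C 'b::complete_space) set)"
proof (rule completeI)
  fix s :: "nat \<Rightarrow> ('a \<Rightarrow>\<^sub>C 'b)" assume "Cauchy s"
  then have "uniformly_Cauchy_on UNIV (\<lambda>n x. apply_bcontfun (s n) x)"
    unfolding Cauchy_def uniformly_Cauchy_on_def by (meson dist_fun_lt_imp_dist_val_lt)
  then obtain l where "uniform_limit UNIV (\<lambda>n. apply_bcontfun (s n)) l sequentially"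
    using Cauchy_uniformly_convergent uniformly_convergent_on_def by blast
  then obtain l' where "s \<longlonglongrightarrow> l'" by (rule uniform_limit_bcontfunE) simp_all
  then show "\<exists>l\<in>UNIV. s \<longlonglongrightarrow> l" by blast
qed

text \<open>In a discrete group the compact set outside which \<Omega> is small is finite.
  Translates by points outside \<open>K\<close> are uniformly small off \<open>K\<close>, and on
  \<open>K\<close> finitely many of them approximate the rest; translates by points of
  \<open>K\<close> are finitely many anyway.\<close>

lemma C0_joint_imp_Ap:
  fixes \<omega> :: "'a::topological_group_add \<Rightarrow> real"
  assumes w: "weight \<omega>" and f: "f \<in> Cb_weighted \<omega>"
    and d: "discrete (UNIV :: 'a set)" and C0: "Omega \<omega> \<in> C0_joint"
  shows "f \<in> Ap \<omega>"
proof -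
  define T where "T = weighted_translate \<omega> f"
  obtain B where B: "0 < B" "\<And>x. norm (f x / complex_of_real (\<omega> x)) \<le> B"
    using Cb_weighted_bound[OF f] by blast
  have le: "norm (apply_bcontfun (T x) y) \<le> B * norm (Omega \<omega> (y, x))" for x y
    unfolding T_def by (rule norm_weighted_translate_le[OF w f B(2)])
  have le': "norm (apply_bcontfun (T x) y) \<le> B" for x y
    using le[of x y] mult_left_mono[OF norm_Omega_le_1[OF w, of "(y, x)"], of B] B(1) by linarith
  have "\<exists>k. finite k \<and> closure (range T) \<subseteq> (\<Union>g\<in>k. ball g e)" if e: "e > 0" for e
  proof -
    \<comment> \<open>With this bound on \<Omega>, a translate by a point outside \<open>K\<close>
      is at most \<open>e / 8\<close> off \<open>K\<close>.\<close>
    have "0 < e / (8 * B)" using e B(1) by simp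
    then obtain K where K: "compact K"
      "\<And>x y. x \<notin> K \<Longrightarrow> y \<notin> K \<Longrightarrow> norm (Omega \<omega> (x, y)) < e / (8 * B)"
      using C0 unfolding C0_joint_def by blast
    have fK: "finite K" using K(1) discrete_UNIV_compact_iff[OF d] by blast
    obtain N where N: "finite N" "N \<subseteq> - K" "\<And>x. x \<in> - K \<Longrightarrow> \<exists>x'\<in>N. \<forall>y\<in>K.
        dist (apply_bcontfun (T x) y) (apply_bcontfun (T x') y) < e / 4"
      using finite_pointwise_net[OF fK, of "\<lambda>x. apply_bcontfun (T x)" B "e / 4" "- K"] le' e by auto
    \<comment> \<open>Closed balls of half the radius: their finite union is closed and hence
      contains the closure of the range.\<close>
    have "T x \<in> (\<Union>g\<in>T ` (N \<union> K). cball g (e / 2))" for x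
    proof (cases "x \<in> K")
      case True
      then show ?thesis using e by (intro UN_I[of "T x"]) auto
    next
      case False
      then obtain x' where x': "x' \<in> N"
        "\<forall>y\<in>K. dist (apply_bcontfun (T x) y) (apply_bcontfun (T x') y) < e / 4"
        using N(3) by blast
      have "dist (apply_bcontfun (T x) y) (apply_bcontfun (T x') y) \<le> e / 2" for y
      proof (cases "y \<in> K")
        case True
        then show ?thesis using x'(2) e by force
      next
        case y: False
        have small: "norm (apply_bcontfun (T z) y) \<le> e / 8" if "z \<notin> K" for z
        proof -
          have "B * norm (Omega \<omega> (y, z)) \<le> B * (e / (8 * B))"
            using K(2)[OF y that] B(1) by (intro mult_left_mono) auto
          also have "\<dots> = e / 8" using B(1) by simp
          finally show ?thesis using le[of z y] by linarith
        qed
        have "x' \<notin> K" using x'(1) N(2) by blast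
        from norm_triangle_ineq4[of "apply_bcontfun (T x) y" "apply_bcontfun (T x') y"]
          small[OF False] small[OF this] e
        show ?thesis by (simp add: dist_norm)
      qed
      then have "dist (T x) (T x') \<le> e / 2" by (rule dist_bound)
      then show ?thesis using x'(1) by (auto simp: dist_commute)
    qed
    then have "range T \<subseteq> (\<Union>g\<in>T ` (N \<union> K). cball g (e / 2))" by (rule image_subsetI)
    moreover have "closed (\<Union>g\<in>T ` (N \<union> K). cball g (e / 2))"
      using N(1) fK by (intro closed_UN) auto
    ultimately have "closure (range T) \<subseteq> (\<Union>g\<in>T ` (N \<union> K). cball g (e / 2))"
      by (rule closure_minimal)
    also have "\<dots> \<subseteq> (\<Union>g\<in>T ` (N \<union> K). ball g e)" using e by force
    finally show ?thesis using N(1) fK by (intro exI[of _ "T ` (N \<union> K)"]) auto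
  qed
  moreover have "complete (closure (range T))"
    by (rule complete_closed_subset[OF closed_closure subset_UNIV complete_UNIV_bcontfun])
  ultimately have "compact (closure (range T))" by (simp add: compact_eq_totally_bounded)
  then show ?thesis using f by (simp add: Ap_def T_def)
qed

text \<open>The bound of \<open>norm_Omega_ge\<close> depends continuously on \<open>x\<close>
  alone, so compactness of \<open>K\<close> makes it uniform in both arguments.\<close>

lemma norm_Omega_bounded_below:
  fixes \<omega> :: "'a::topological_group_add \<Rightarrow> real"
  assumes w: "weight \<omega>" and K: "compact K"
  obtains c where "0 < c" "\<And>x y. x \<in> K \<Longrightarrow> c \<le> norm (Omega \<omega> (x, y))"
proof -
  have cw: "continuous_on UNIV \<omega>" using w by (simp add: weight_def)
  have "continuous_on K (\<lambda>x. \<omega> (- x) * \<omega> x)"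
    by (intro continuous_intros continuous_on_compose2[OF cw]) auto
  then have "bounded ((\<lambda>x. \<omega> (- x) * \<omega> x) ` K)"
    using K compact_continuous_image compact_imp_bounded by blast
  then obtain M where M: "0 < M" "\<And>x. x \<in> K \<Longrightarrow> norm (\<omega> (- x) * \<omega> x) \<le> M"
    by (auto simp: bounded_pos)
  show thesis
  proof (rule that[of "1 / M"])
    show "0 < 1 / M" using M(1) by simp
    fix x y assume "x \<in> K"
    then have "\<omega> (- x) * \<omega> x \<le> M" using M(2) by fastforce
    moreover have "0 < \<omega> (- x) * \<omega> x" using weight_pos[OF w] by simp
    ultimately have "1 / M \<le> 1 / (\<omega> (- x) * \<omega> x)" by (simp add: frac_le)
    then show "1 / M \<le> norm (Omega \<omega> (x, y))" using norm_Omega_ge[OF w] by (rule order_trans)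
  qed
qed

text \<open>A finite open neighbourhood of 0 in a Hausdorff group would make \<open>{0}\<close>
  open.\<close>

lemma nondiscrete_infinite_compact_neighbourhood:
  assumes lc: "locally_compact_space (euclidean :: 'a::{topological_group_add, t2_space} topology)"
    and nd: "\<not> discrete (UNIV :: 'a set)"
  obtains U K where "open U" "compact K" "(0 :: 'a) \<in> U" "U \<subseteq> K" "infinite U"
proof -
  have "\<exists>U K. openin euclidean U \<and> compactin euclidean K \<and> (0 :: 'a) \<in> U \<and> U \<subseteq> K"
    using lc unfolding locally_compact_space_def by (metis UNIV_I topspace_euclidean)
  then obtain U K where U: "open U" "compact K" "(0 :: 'a) \<in> U" "U \<subseteq> K" by auto
  have "infinite U"
  proof
    assume "finite U"
    then have "open (U - (U - {0}))" using U(1) by (intro open_Diff finite_imp_closed) auto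
    moreover have "U - (U - {0}) = {0}" using U(3) by auto
    ultimately show False using nd discrete_UNIV_if_open_singleton[of 0] by auto
  qed
  with U that show thesis by blast
qed

text \<open>In a nondiscrete group an injective sequence inside a compact neighbourhood of 0, used
  in both arguments, keeps \<Omega> away from 0.\<close>

lemma zero_cluster_imp_discrete:
  fixes \<omega> :: "'a::{topological_group_add, t2_space} \<Rightarrow> real"
  assumes lc: "locally_compact_space (euclidean :: 'a topology)"
    and inf: "infinite (UNIV :: 'a set)" and w: "weight \<omega>" and zc: "zero_cluster (Omega \<omega>)"
  shows "discrete (UNIV :: 'a set)"
proof (rule ccontr)
  assume "\<not> discrete (UNIV :: 'a set)"
  then obtain U K where U: "compact K" "U \<subseteq> K" "infinite (U :: 'a set)"
    using nondiscrete_infinite_compact_neighbourhood[OF lc] by metis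
  obtain c where c: "0 < c" "\<And>x y. x \<in> K \<Longrightarrow> c \<le> norm (Omega \<omega> (x, y))"
    using norm_Omega_bounded_below[OF w U(1)] by blast
  obtain u :: "nat \<Rightarrow> 'a" where u: "inj u" "range u \<subseteq> U" using infinite_countable_subset[OF U(3)] by blast
  have "u n \<in> K" for n using u(2) U(2) by blast
  then have "\<forall>n. eventually (\<lambda>m. c \<le> norm (Omega \<omega> (u n, u m))) sequentially" using c(2) by simp
  with zero_cluster_no_grid(1)[OF zc norm_Omega_le_1[OF w] c(1) u(1) u(1)] show False by blast
qed

text \<open>A point of the closure where \<psi> is nonzero has a neighbourhood containing
  \<open>t i\<close> for only finitely many \<open>i\<close>; it is thus itself a value of
  \<open>t\<close> and isolated in the closure. Around a zero of \<psi> it suffices to remove the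
  finitely many values of \<open>t\<close> at which \<psi> is large.\<close>

lemma continuous_on_closure_range_cluster:
  fixes t :: "'i \<Rightarrow> 'b::topological_space" and \<psi> :: "'b \<Rightarrow> complex"
  assumes t1: "\<And>s :: 'b. closed {s}"
    and fin: "\<And>\<delta>. 0 < \<delta> \<Longrightarrow> finite {i. \<delta> \<le> norm (\<psi> (t i))}"
    and cluster: "\<And>s. (\<And>U. open U \<Longrightarrow> s \<in> U \<Longrightarrow> infinite {i. t i \<in> U}) \<Longrightarrow> \<psi> s = 0"
  shows "continuous_on (closure (range t)) \<psi>"
proof -
  have fin_closed: "closed F" if "finite F" for F :: "'b set"
    using that by induction (auto intro: closed_Un[OF t1, simplified])
  have isolated: "s \<in> t ` {i. t i \<in> U}"
    if s: "s \<in> closure (range t)" and U: "open U" "s \<in> U" and f: "finite {i. t i \<in> U}" for s U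
  proof (rule ccontr)
    assume "s \<notin> t ` {i. t i \<in> U}"
    then have "s \<in> U - t ` {i. t i \<in> U}" "open (U - t ` {i. t i \<in> U})"
      using U f fin_closed by (auto intro: open_Diff)
    then have "(U - t ` {i. t i \<in> U}) \<inter> range t \<noteq> {}"
      using s by (auto simp: closure_iff_nhds_not_empty)
    then show False by auto
  qed
  have large: "s \<in> t ` {i. \<delta> \<le> norm (\<psi> (t i))}"
    if s: "s \<in> closure (range t)" and \<delta>: "0 < \<delta>" "\<delta> \<le> norm (\<psi> s)" for s \<delta>
  proof -
    have "\<psi> s \<noteq> 0" using \<delta> by auto
    then obtain U where "open U" "s \<in> U" "finite {i. t i \<in> U}" using cluster by blast
    then have "s \<in> t ` {i. t i \<in> U}" using isolated[OF s] by blast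
    then show ?thesis using \<delta>(2) by auto
  qed
  show ?thesis
    unfolding continuous_on_topological
  proof (intro ballI allI impI)
    fix s V assume s: "s \<in> closure (range t)" and V: "open V" "\<psi> s \<in> V"
    show "\<exists>A. open A \<and> s \<in> A \<and> (\<forall>s'\<in>closure (range t). s' \<in> A \<longrightarrow> \<psi> s' \<in> V)"
    proof (cases "\<psi> s = 0")
      case True
      obtain \<delta> where \<delta>: "0 < \<delta>" "ball (\<psi> s) \<delta> \<subseteq> V" using V open_contains_ball by blast
      define M where "M = t ` {i. \<delta> \<le> norm (\<psi> (t i))} - {s}"
      have "closed M" using fin[OF \<delta>(1)] by (intro fin_closed) (simp add: M_def)
      then have "open (- M)" by (rule open_Compl)
      moreover have "\<psi> s' \<in> V" if "s' \<in> closure (range t)" "s' \<in> - M" for s'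
      proof (cases "s' = s")
        case False
        then have "norm (\<psi> s') < \<delta>" using large[OF that(1) \<delta>(1)] that(2) by (force simp: M_def)
        then show ?thesis using \<delta>(2) True by (auto simp: subset_iff)
      qed (use V in simp)
      ultimately show ?thesis by (intro exI[of _ "- M"]) (auto simp: M_def)
    next
      case False
      then obtain U where U: "open U" "s \<in> U" "finite {i. t i \<in> U}" using cluster by blast
      define A where "A = U - (t ` {i. t i \<in> U} - {s})"
      have "open A" unfolding A_def using U by (intro open_Diff fin_closed) auto
      moreover have "s' = s" if "s' \<in> closure (range t)" "s' \<in> A" for s'
      proof -
        have "s' \<in> U" using that(2) by (simp add: A_def)
        then have "s' \<in> t ` {i. t i \<in> U}" using isolated[OF that(1) U(1) _ U(3)] by simp
        then show ?thesis using that(2) unfolding A_def by blast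
      qed
      moreover have "s \<in> A" using U(2) by (simp add: A_def)
      ultimately show ?thesis using V(2) by metis
    qed
  qed
qed

section \<open>Diffuse functionals on bounded functions\<close>

text \<open>A bounded functional on the space of bounded functions, presented on plain functions:
  these can be cut off at arbitrary sets and carry the product topology. Nothing is demanded on
  unbounded arguments.\<close>

locale linf_functional =
  fixes \<psi> :: "('a \<Rightarrow> complex) \<Rightarrow> complex" and C :: real
  assumes add: "bounded (range h) \<Longrightarrow> bounded (range k) \<Longrightarrow> \<psi> (\<lambda>y. h y + k y) = \<psi> h + \<psi> k"
    and scale: "bounded (range h) \<Longrightarrow> \<psi> (\<lambda>y. c * h y) = c * \<psi> h"
    and bound: "(\<And>y. norm (h y) \<le> B) \<Longrightarrow> norm (\<psi> h) \<le> C * B"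
begin

lemma C_nonneg: "0 \<le> C"
proof -
  have "norm (\<psi> (\<lambda>_. 0)) \<le> C * 1" by (rule bound) simp
  then show ?thesis using norm_ge_zero[of "\<psi> (\<lambda>_. 0)"] by linarith
qed

lemma zero: "\<psi> (\<lambda>_. 0) = 0"
  using scale[of "\<lambda>_. 0" 0] by (simp add: image_def)

lemma sum:
  assumes "finite I" "\<And>i. i \<in> I \<Longrightarrow> bounded (range (h i))"
  shows "\<psi> (\<lambda>y. \<Sum>i\<in>I. h i y) = (\<Sum>i\<in>I. \<psi> (h i)) \<and> bounded (range (\<lambda>y. \<Sum>i\<in>I. h i y))"
  using assms
proof induction
  case empty
  then show ?case by (simp add: zero image_def)
next
  case (insert i I)
  then show ?case by (auto simp: add intro!: bounded_plus_comp)
qed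

text \<open>Rotating each \<open>h i\<close> makes its value under \<psi> nonnegative, and
  disjointness of the supports keeps the rotated sum bounded by 1. This bounds the total variation
  of the finitely additive measure behind \<psi>.\<close>

lemma sum_norm_disjoint_le:
  assumes I: "finite I" and disj: "disjoint_family_on D I"
    and h1: "\<And>i y. i \<in> I \<Longrightarrow> norm (h i y) \<le> 1" and h0: "\<And>i y. i \<in> I \<Longrightarrow> y \<notin> D i \<Longrightarrow> h i y = 0"
  shows "(\<Sum>i\<in>I. norm (\<psi> (h i))) \<le> C"
proof -
  \<comment> \<open>The conjugate phase; it is 0 when \<open>\<psi> (h i) = 0\<close>, so its norm
    is only bounded by 1.\<close>
  define a where "a i = cnj (\<psi> (h i)) / norm (\<psi> (h i))" for i
  have a1: "norm (a i) \<le> 1" for i by (simp add: a_def norm_divide)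
  have a: "a i * \<psi> (h i) = norm (\<psi> (h i))" for i
    by (simp add: a_def complex_norm_square[symmetric] power2_eq_square mult.commute)
  have b: "bounded (range (h i))" if "i \<in> I" for i
    using h1[OF that] by (auto simp: bounded_iff)
  then have b': "bounded (range (\<lambda>y. a i * h i y))" if "i \<in> I" for i
    using bounded_linear_image[OF b[OF that] bounded_linear_mult_right[of "a i"]] by (simp add: image_image)
  have "\<psi> (\<lambda>y. \<Sum>i\<in>I. a i * h i y) = (\<Sum>i\<in>I. a i * \<psi> (h i))"
    using sum[OF I b'] scale[OF b] by simp
  also have "\<dots> = complex_of_real (\<Sum>i\<in>I. norm (\<psi> (h i)))" by (simp add: a)
  finally have eq: "norm (\<psi> (\<lambda>y. \<Sum>i\<in>I. a i * h i y)) = (\<Sum>i\<in>I. norm (\<psi> (h i)))"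
    by (simp add: sum_nonneg del: of_real_sum)
  have "norm (\<Sum>i\<in>I. a i * h i y) \<le> 1" for y
  proof (cases "\<exists>j\<in>I. y \<in> D j")
    case True
    then obtain j where j: "j \<in> I" "y \<in> D j" by blast
    have "a i * h i y = 0" if "i \<in> I - {j}" for i
      using that j disj h0[of i y] by (auto simp: disjoint_family_on_def)
    then have "(\<Sum>i\<in>I - {j}. a i * h i y) = 0" by (rule sum.neutral[OF ballI])
    then have "(\<Sum>i\<in>I. a i * h i y) = a j * h j y"
      using I j(1) by (simp add: sum.remove[of I j])
    also have "norm \<dots> \<le> 1"
      using mult_mono[OF a1[of j] h1[OF j(1), of y]] by (simp add: norm_mult)
    finally show ?thesis .
  next
    case False
    then show ?thesis using h0 by (simp add: sum.neutral)
  qed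
  from bound[of "\<lambda>y. \<Sum>i\<in>I. a i * h i y" 1, OF this] show ?thesis by (simp add: eq)
qed

text \<open>A lower bound for the total variation on \<open>D\<close> of the finitely additive
  measure behind \<psi>. Asking for a single test function avoids suprema.\<close>

definition heavy :: "'a set \<Rightarrow> real \<Rightarrow> bool" where
  "heavy D \<delta> \<longleftrightarrow> (\<exists>h. (\<forall>y. norm (h y) \<le> 1) \<and> (\<forall>y. y \<notin> D \<longrightarrow> h y = 0) \<and> \<delta> \<le> norm (\<psi> h))"

lemma heavy_mono: "heavy D \<delta> \<Longrightarrow> \<delta>' \<le> \<delta> \<Longrightarrow> heavy D \<delta>'"
  unfolding heavy_def using order_trans by blast

lemma heavy_disjoint_card_le:
  assumes I: "finite I" and disj: "disjoint_family_on D I" and heavy: "\<And>i. i \<in> I \<Longrightarrow> heavy (D i) \<delta>"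
  shows "real (card I) * \<delta> \<le> C"
proof -
  obtain h where h: "\<And>i. i \<in> I \<Longrightarrow>
      (\<forall>y. norm (h i y) \<le> 1) \<and> (\<forall>y. y \<notin> D i \<longrightarrow> h i y = 0) \<and> \<delta> \<le> norm (\<psi> (h i))"
    using heavy unfolding heavy_def by metis
  have "(\<Sum>i\<in>I. \<delta>) \<le> (\<Sum>i\<in>I. norm (\<psi> (h i)))" by (rule sum_mono) (use h in blast)
  also have "\<dots> \<le> C" by (rule sum_norm_disjoint_le[OF I disj]) (use h in blast)+
  finally show ?thesis by simp
qed

text \<open>Split the test function along \<open>E\<close>: its part on \<open>E\<close> has value
  below \<open>\<delta>'\<close>, so the rest keeps the remaining mass.\<close>

lemma heavy_Diff:
  assumes D: "heavy D \<delta>" and E: "\<not> heavy (D \<inter> E) \<delta>'"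
  shows "heavy (D - E) (\<delta> - \<delta>')"
proof -
  obtain h where h: "\<And>y. norm (h y) \<le> 1" "\<And>y. y \<notin> D \<Longrightarrow> h y = 0" "\<delta> \<le> norm (\<psi> h)"
    using D by (auto simp: heavy_def)
  define h1 where "h1 y = (if y \<in> E then h y else 0)" for y
  define h2 where "h2 y = (if y \<in> E then 0 else h y)" for y
  have n: "\<And>y. norm (h1 y) \<le> 1" "\<And>y. norm (h2 y) \<le> 1" using h(1) by (auto simp: h1_def h2_def)
  then have "bounded (range h1)" "bounded (range h2)" by (auto simp: bounded_iff)
  then have "\<psi> (\<lambda>y. h1 y + h2 y) = \<psi> h1 + \<psi> h2" by (rule add)
  moreover have "(\<lambda>y. h1 y + h2 y) = h" by (auto simp: h1_def h2_def)
  ultimately have "norm (\<psi> h) \<le> norm (\<psi> h1) + norm (\<psi> h2)" by (metis norm_triangle_ineq)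
  moreover have "norm (\<psi> h1) < \<delta>'"
  proof (rule ccontr)
    assume "\<not> norm (\<psi> h1) < \<delta>'"
    then have "heavy (D \<inter> E) \<delta>'"
      unfolding heavy_def using n(1) h(2) by (intro exI[of _ h1]) (auto simp: h1_def)
    with E show False by blast
  qed
  ultimately have "\<delta> - \<delta>' \<le> norm (\<psi> h2)" using h(3) by linarith
  then show ?thesis
    unfolding heavy_def using n(2) h(2) by (intro exI[of _ h2]) (auto simp: h2_def)
qed

lemma heavy_Diff_UN:
  fixes \<delta> \<delta>' :: real
  assumes "finite I" "heavy D \<delta>" "\<And>i. i \<in> I \<Longrightarrow> \<not> heavy (D \<inter> E i) \<delta>'"
  shows "heavy (D - (\<Union>i\<in>I. E i)) (\<delta> - real (card I) * \<delta>')"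
  using assms
proof induction
  case empty
  then show ?case by simp
next
  case (insert i I)
  let ?D = "D - (\<Union>i\<in>I. E i)"
  have nh: "\<not> heavy (?D \<inter> E i) \<delta>'"
  proof
    assume "heavy (?D \<inter> E i) \<delta>'"
    then have "heavy (D \<inter> E i) \<delta>'" unfolding heavy_def by blast
    with insert.prems show False by blast
  qed
  have "heavy ?D (\<delta> - real (card I) * \<delta>')"
    using insert.prems by (intro insert.IH) auto
  from heavy_Diff[OF this nh] have "heavy (?D - E i) ((\<delta> - real (card I) * \<delta>') - \<delta>')" .
  moreover have "?D - E i = D - (\<Union>i\<in>insert i I. E i)" by auto
  ultimately show ?case using insert.hyps by (simp add: algebra_simps)
qed

text \<open>Otherwise arbitrarily many of the traces \<open>D \<inter> A j\<close> could be made disjoint at the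
  cost of half of their mass.\<close>

lemma heavy_refine:
  assumes \<delta>: "0 < \<delta>" and inf: "infinite {j. heavy (D \<inter> A j) \<delta>}" and F: "finite F"
  obtains i \<delta>' where "i \<notin> F" "0 < \<delta>'" "infinite {j. heavy (D \<inter> A i \<inter> A j) \<delta>'}"
proof -
  have "\<exists>i \<delta>'. i \<notin> F \<and> 0 < \<delta>' \<and> infinite {j. heavy (D \<inter> A i \<inter> A j) \<delta>'}"
  proof (rule ccontr)
    assume "\<nexists>i \<delta>'. i \<notin> F \<and> 0 < \<delta>' \<and> infinite {j. heavy (D \<inter> A i \<inter> A j) \<delta>'}"
    then have fin: "finite {j. heavy (D \<inter> A i \<inter> A j) \<delta>'}" if "i \<notin> F" "0 < \<delta>'" for i \<delta>'
      using that by blast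
    \<comment> \<open>More than \<open>C\<close> would be the total mass of \<open>N\<close>
      disjoint sets of mass \<open>\<delta> / 2\<close> each.\<close>
    obtain N :: nat where N: "2 * C / \<delta> < N" using reals_Archimedean2 by blast
    have N0: "0 < real N" using N C_nonneg \<delta> by (smt (verit) divide_nonneg_pos)
    \<comment> \<open>Removing fewer than \<open>N\<close> traces of mass below
      \<open>\<delta>'\<close> costs at most half of \<delta>.\<close>
    define \<delta>' where "\<delta>' = \<delta> / (2 * N)"
    have \<delta>': "0 < \<delta>'" using \<delta> N0 by (simp add: \<delta>'_def)
    define J where "J = {j. heavy (D \<inter> A j) \<delta>} - F"
    have J: "infinite J" using inf F by (simp add: J_def)
    \<comment> \<open>The chosen indices lie in \<open>J\<close>, hence outside \<open>F\<close>, so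
      each of them rules out only finitely many later ones.\<close>
    define P where "P E v \<longleftrightarrow> v \<notin> E \<and> (\<forall>i\<in>E. \<not> heavy (D \<inter> A i \<inter> A v) \<delta>')" for E v
    obtain v where v: "\<And>n :: nat. v ` {..<n} \<subseteq> J" "\<And>n. P (v ` {..<n}) (v n)"
    proof (rule exists_seq_with_invariant[of "\<lambda>E. E \<subseteq> J" P])
      fix E assume E: "finite E" "E \<subseteq> J"
      have "finite (E \<union> (\<Union>i\<in>E. {j. heavy (D \<inter> A i \<inter> A j) \<delta>'}))"
        using E fin[OF _ \<delta>'] by (auto simp: J_def)
      then obtain v where "v \<in> J" "v \<notin> E \<union> (\<Union>i\<in>E. {j. heavy (D \<inter> A i \<inter> A j) \<delta>'})"
        using J by (metis finite_subset subsetI)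
      then show "\<exists>v. P E v \<and> insert v E \<subseteq> J" using E(2) by (auto simp: P_def)
    qed auto
    have vJ: "v n \<in> J" for n using v(1)[of "Suc n"] by auto
    have inj: "inj v" by (rule inj_if_avoiding) (use v(2) in \<open>auto simp: P_def\<close>)
    define D' where "D' n = D \<inter> A (v n) - (\<Union>i\<in>v ` {..<n}. A i)" for n
    have "heavy (D' n) (\<delta> / 2)" if "n \<in> {..<N}" for n
    proof -
      have nh: "\<not> heavy (D \<inter> A (v n) \<inter> A i) \<delta>'" if "i \<in> v ` {..<n}" for i
      proof -
        have "D \<inter> A (v n) \<inter> A i = D \<inter> A i \<inter> A (v n)" by blast
        moreover have "\<forall>i\<in>v ` {..<n}. \<not> heavy (D \<inter> A i \<inter> A (v n)) \<delta>'"
          using v(2)[of n] unfolding P_def by (rule conjunct2)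
        ultimately show ?thesis using that by metis
      qed
      have "heavy (D' n) (\<delta> - card (v ` {..<n}) * \<delta>')"
        unfolding D'_def by (rule heavy_Diff_UN[OF _ _ nh]) (use vJ[of n] in \<open>auto simp: J_def\<close>)
      moreover have "\<delta> / 2 \<le> \<delta> - card (v ` {..<n}) * \<delta>'"
      proof -
        have "card (v ` {..<n}) = n" using inj by (simp add: card_image inj_on_subset)
        moreover have "real n * \<delta>' \<le> real N * \<delta>'" using that \<delta>' by (intro mult_right_mono) auto
        moreover have "real N * \<delta>' = \<delta> / 2" using N0 by (simp add: \<delta>'_def)
        ultimately show ?thesis by simp
      qed
      ultimately show ?thesis by (rule heavy_mono)
    qed
    moreover have "disjoint_family_on D' {..<N}"
      unfolding disjoint_family_on_def
    proof (intro ballI impI)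
      fix m n :: nat assume "m \<noteq> n"
      then consider "m < n" | "n < m" by linarith
      then show "D' m \<inter> D' n = {}" by cases (auto simp: D'_def)
    qed
    ultimately have "real (card {..<N}) * (\<delta> / 2) \<le> C"
      by (intro heavy_disjoint_card_le) auto
    then show False using N \<delta> by (simp add: field_simps)
  qed
  then show thesis using that by blast
qed

section \<open>Splitting a functional into atomic and diffuse parts\<close>

lemma summable_point_masses: "(\<lambda>x. norm (\<psi> (\<lambda>y. of_bool (y = x)))) summable_on UNIV"
proof (rule nonneg_bdd_above_summable_on)
  have "(\<Sum>x\<in>F. norm (\<psi> (\<lambda>y. of_bool (y = x)))) \<le> C" if "finite F" for F
    by (rule sum_norm_disjoint_le[OF that, of "\<lambda>x. {x}"]) (auto simp: disjoint_family_on_def)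
  then show "bdd_above (sum (\<lambda>x. norm (\<psi> (\<lambda>y. of_bool (y = x)))) ` {F. F \<subseteq> UNIV \<and> finite F})"
    by (auto simp: bdd_above_def)
qed simp

text \<open>On bounded functions, integration against the point masses of \<psi>, which form an
  element of l^1.\<close>

definition atomic_part :: "('a \<Rightarrow> complex) \<Rightarrow> complex" where
  "atomic_part h = (\<Sum>\<^sub>\<infinity>x. h x * \<psi> (\<lambda>y. of_bool (y = x)))"

definition diffuse_part :: "('a \<Rightarrow> complex) \<Rightarrow> complex" where
  "diffuse_part h = \<psi> h - atomic_part h"

lemma summable_atomic_part:
  assumes "\<And>x. norm (h x) \<le> B"
  shows "(\<lambda>x. norm (h x * \<psi> (\<lambda>y. of_bool (y = x)))) summable_on UNIV"
proof (rule summable_on_comparison_test)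
  show "(\<lambda>x. B * norm (\<psi> (\<lambda>y. of_bool (y = x)))) summable_on UNIV"
    by (rule summable_on_cmult_right[OF summable_point_masses])
qed (auto simp: norm_mult intro: mult_right_mono assms)

lemma norm_atomic_part_le:
  assumes "\<And>x. norm (h x) \<le> B"
  shows "norm (atomic_part h) \<le> C * B"
proof -
  have B: "0 \<le> B" using assms norm_ge_zero order_trans by blast
  have "norm (atomic_part h) \<le> (\<Sum>\<^sub>\<infinity>x. norm (h x * \<psi> (\<lambda>y. of_bool (y = x))))"
    unfolding atomic_part_def by (rule norm_infsum_bound[OF summable_atomic_part[OF assms]])
  also have "\<dots> \<le> (\<Sum>\<^sub>\<infinity>x. B * norm (\<psi> (\<lambda>y. of_bool (y = x))))"
    by (rule infsum_mono[OF summable_atomic_part[OF assms] summable_on_cmult_right[OF summable_point_masses]])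
      (auto simp: norm_mult intro: mult_right_mono assms)
  also have "\<dots> = B * (\<Sum>\<^sub>\<infinity>x. norm (\<psi> (\<lambda>y. of_bool (y = x))))" by (rule infsum_cmult_right')
  also have "\<dots> \<le> B * C"
  proof (rule mult_left_mono[OF _ B], rule infsum_le_finite_sums[OF summable_point_masses])
    fix F :: "'a set" assume "finite F"
    then show "(\<Sum>x\<in>F. norm (\<psi> (\<lambda>y. of_bool (y = x)))) \<le> C"
      by (rule sum_norm_disjoint_le[of _ "\<lambda>x. {x}"]) (auto simp: disjoint_family_on_def)
  qed
  finally show ?thesis by (simp add: mult.commute)
qed

text \<open>One \<open>C\<close> in the constant comes from \<psi> and the other from its atomic
  part.\<close>

lemma linf_functional_diffuse_part: "linf_functional diffuse_part (2 * C)"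
proof
  fix h k :: "'a \<Rightarrow> complex" assume hk: "bounded (range h)" "bounded (range k)"
  have s: "(\<lambda>x. h x * \<psi> (\<lambda>y. of_bool (y = x))) summable_on UNIV" if "bounded (range h)" for h :: "'a \<Rightarrow> complex"
  proof -
    obtain B where "\<And>x. norm (h x) \<le> B" using \<open>bounded (range h)\<close> by (auto simp: bounded_iff)
    from abs_summable_summable[OF summable_atomic_part[OF this]] show ?thesis .
  qed
  have "atomic_part (\<lambda>y. h y + k y) = atomic_part h + atomic_part k"
    unfolding atomic_part_def by (simp add: distrib_right infsum_add[OF s[OF hk(1)] s[OF hk(2)]])
  then show "diffuse_part (\<lambda>y. h y + k y) = diffuse_part h + diffuse_part k"
    by (simp add: diffuse_part_def add[OF hk])
next
  fix h :: "'a \<Rightarrow> complex" and c assume "bounded (range h)"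
  moreover have "atomic_part (\<lambda>y. c * h y) = c * atomic_part h"
    unfolding atomic_part_def by (simp add: mult.assoc infsum_cmult_right')
  ultimately show "diffuse_part (\<lambda>y. c * h y) = c * diffuse_part h"
    by (simp add: diffuse_part_def scale right_diff_distrib)
next
  fix h :: "'a \<Rightarrow> complex" and B assume B: "\<And>y. norm (h y) \<le> B"
  show "norm (diffuse_part h) \<le> 2 * C * B"
    using norm_triangle_ineq4[of "\<psi> h" "atomic_part h"] bound[of h B, OF B] norm_atomic_part_le[of h B, OF B]
    by (simp add: diffuse_part_def)
qed

lemma diffuse_part_finite_support:
  assumes "finite {y. h y \<noteq> 0}"
  shows "diffuse_part h = 0"
proof -
  let ?F = "{y. h y \<noteq> 0}"
  have b: "bounded (range (\<lambda>y. of_bool (y = x) :: complex))" for x :: 'a by (auto simp: bounded_iff)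
  then have b': "bounded (range (\<lambda>y. h x * of_bool (y = x)))" for x
    by (auto simp: bounded_iff intro!: exI[of _ "norm (h x)"])
  have "h = (\<lambda>y. \<Sum>x\<in>?F. h x * of_bool (y = x))"
    using assms by (auto simp: of_bool_def if_distrib sum.delta cong: if_cong)
  then have "\<psi> h = \<psi> (\<lambda>y. \<Sum>x\<in>?F. h x * of_bool (y = x))" by (rule arg_cong)
  also have "\<dots> = (\<Sum>x\<in>?F. \<psi> (\<lambda>y. h x * of_bool (y = x)))"
    by (rule conjunct1[OF sum[OF assms b']])
  also have "\<dots> = (\<Sum>x\<in>?F. h x * \<psi> (\<lambda>y. of_bool (y = x)))" by (simp add: scale[OF b])
  also have "\<dots> = atomic_part h"
  proof -
    have "atomic_part h = (\<Sum>\<^sub>\<infinity>x\<in>?F. h x * \<psi> (\<lambda>y. of_bool (y = x)))"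
      unfolding atomic_part_def by (rule infsum_cong_neutral) auto
    then show ?thesis using assms by simp
  qed
  finally show ?thesis by (simp add: diffuse_part_def)
qed

text \<open>Finite partial sums depend on finitely many coordinates, hence are continuous for
  pointwise convergence, and on a uniformly bounded set they converge uniformly by the Weierstrass
  test.\<close>

lemma continuous_on_atomic_part:
  assumes "\<And>s y. s \<in> S \<Longrightarrow> norm (s y) \<le> B"
  shows "continuous_on S atomic_part"
proof -
  have "uniform_limit S (\<lambda>X s. \<Sum>x\<in>X. s x * \<psi> (\<lambda>y. of_bool (y = x)))
      (\<lambda>s. \<Sum>\<^sub>\<infinity>x\<in>UNIV. s x * \<psi> (\<lambda>y. of_bool (y = x))) (finite_subsets_at_top UNIV)"
  proof (rule Weierstrass_m_test_general)
    show "(\<lambda>x. B * norm (\<psi> (\<lambda>y. of_bool (y = x)))) summable_on UNIV"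
      by (rule summable_on_cmult_right[OF summable_point_masses])
  qed (auto simp: norm_mult intro: mult_right_mono assms)
  moreover have "continuous_on S (\<lambda>s. \<Sum>x\<in>X. s x * \<psi> (\<lambda>y. of_bool (y = x)))" for X
    by (intro continuous_intros continuous_on_subset[OF continuous_on_product_coordinates subset_UNIV])
  ultimately show ?thesis
    unfolding atomic_part_def[abs_def] by (intro uniform_limit_theorem[of _ _ "finite_subsets_at_top UNIV"]) auto
qed

end

locale diffuse_functional = linf_functional +
  assumes diffuse: "finite {y. h y \<noteq> 0} \<Longrightarrow> \<psi> h = 0"
begin

lemma heavy_infinite:
  assumes "heavy D \<delta>" "0 < \<delta>"
  shows "infinite D"
proof
  assume "finite D"
  obtain h where h: "\<And>y. y \<notin> D \<Longrightarrow> h y = 0" "\<delta> \<le> norm (\<psi> h)"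
    using assms(1) by (auto simp: heavy_def)
  have "finite {y. h y \<noteq> 0}" by (rule finite_subset[OF _ \<open>finite D\<close>]) (use h(1) in auto)
  from diffuse[OF this] h(2) assms(2) show False by simp
qed

lemma infinitely_many_heavy_grid:
  assumes \<delta>: "0 < \<delta>" and inf: "infinite {j. heavy (A j) \<delta>}"
  obtains i y where "inj i" "inj y" "\<And>n k :: nat. n \<le> k \<Longrightarrow> y k \<in> A (i n)"
proof -
  define good where "good D \<longleftrightarrow> (\<exists>\<delta>>0. infinite {j. heavy (D \<inter> A j) \<delta>})" for D
  define Q where "Q E \<longleftrightarrow> good (\<Inter>p\<in>E. A (fst p))" for E :: "('b \<times> 'a) set"
  define P where "P E p \<longleftrightarrow> fst p \<notin> fst ` E \<and> snd p \<notin> snd ` E \<and> snd p \<in> A (fst p) \<and>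
      (\<forall>q\<in>E. snd p \<in> A (fst q))" for E p
  obtain v where v: "\<And>n :: nat. P (v ` {..<n}) (v n)"
  proof (rule exists_seq_with_invariant[of Q P])
    show "Q {}" using \<delta> inf by (auto simp: Q_def good_def)
    fix E assume E: "finite E" "Q E"
    define D where "D = (\<Inter>p\<in>E. A (fst p))"
    obtain \<delta>1 where \<delta>1: "0 < \<delta>1" "infinite {j. heavy (D \<inter> A j) \<delta>1}"
      using E(2) by (auto simp: Q_def good_def D_def)
    obtain i \<delta>2 where i: "i \<notin> fst ` E" "0 < \<delta>2" "infinite {j. heavy (D \<inter> A i \<inter> A j) \<delta>2}"
      using heavy_refine[OF \<delta>1, of "fst ` E"] E(1) by blast
    then obtain j where "heavy (D \<inter> A i \<inter> A j) \<delta>2" using infinite_imp_nonempty by blast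
    then have "infinite (D \<inter> A i)"
      using heavy_infinite i(2) finite_Int by blast
    then have "infinite (D \<inter> A i - snd ` E)" using E(1) by simp
    then obtain y where y: "y \<in> D \<inter> A i" "y \<notin> snd ` E" using infinite_imp_nonempty by blast
    have "P E (i, y)" using i(1) y by (auto simp: P_def D_def)
    moreover have "(\<Inter>p\<in>insert (i, y) E. A (fst p)) = D \<inter> A i" by (auto simp: D_def)
    then have "Q (insert (i, y) E)" unfolding Q_def good_def using i(2,3) by auto
    ultimately show "\<exists>v. P E v \<and> Q (insert v E)" by blast
  qed (rule that)
  show thesis
  proof (rule that[of "\<lambda>n. fst (v n)" "\<lambda>n. snd (v n)"])
    show "inj (\<lambda>n. fst (v n))" "inj (\<lambda>n. snd (v n))"
      using v by (auto intro!: inj_if_avoiding simp: P_def image_image)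
    fix n k :: nat assume "n \<le> k"
    then show "snd (v k) \<in> A (fst (v n))" using v[of k] by (cases "n = k") (auto simp: P_def)
  qed
qed

end

section \<open>Zero cluster weights\<close>

lemma discrete_bounded_in_bcontfun:
  fixes h :: "'a::topological_space \<Rightarrow> complex"
  assumes "discrete (UNIV :: 'a set)" "bounded (range h)"
  shows "h \<in> bcontfun"
  using assms discrete_UNIV_continuous_on by (auto simp: bcontfun_def)

text \<open>On a discrete space every bounded function is continuous, so \<open>Bcontfun\<close> has
  its intended meaning on all bounded functions.\<close>

lemma linf_functional_Cb_dual:
  fixes \<phi> :: "('a::topological_space \<Rightarrow>\<^sub>C complex) \<Rightarrow> complex"
  assumes d: "discrete (UNIV :: 'a set)" and \<phi>: "\<phi> \<in> Cb_dual"
  obtains C where "linf_functional (\<lambda>h. \<phi> (Bcontfun h)) C"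
proof -
  have bl: "bounded_linear \<phi>" using \<phi> by (simp add: Cb_dual_def)
  obtain C where C: "0 < C" "\<And>g. norm (\<phi> g) \<le> norm g * C"
    using bounded_linear.pos_bounded[OF bl] by blast
  note inv = Bcontfun_inverse[OF discrete_bounded_in_bcontfun[OF d]]
  have "linf_functional (\<lambda>h. \<phi> (Bcontfun h)) C"
  proof
    fix h k :: "'a \<Rightarrow> complex" assume hk: "bounded (range h)" "bounded (range k)"
    then have "bounded (range (\<lambda>y. h y + k y))" by (rule bounded_plus_comp)
    then have "Bcontfun (\<lambda>y. h y + k y) = Bcontfun h + Bcontfun k"
      by (intro bcontfun_eqI) (simp add: inv hk)
    then show "\<phi> (Bcontfun (\<lambda>y. h y + k y)) = \<phi> (Bcontfun h) + \<phi> (Bcontfun k)"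
      by (simp add: linear_add[OF bounded_linear.linear[OF bl]])
  next
    fix h :: "'a \<Rightarrow> complex" and c assume "bounded (range h)"
    moreover have "\<phi> (Bcontfun (\<lambda>y. c * apply_bcontfun (Bcontfun h) y)) = c * \<phi> (Bcontfun h)"
      using \<phi> unfolding Cb_dual_def by blast
    ultimately show "\<phi> (Bcontfun (\<lambda>y. c * h y)) = c * \<phi> (Bcontfun h)" by (simp add: inv)
  next
    fix h :: "'a \<Rightarrow> complex" and B assume B: "\<And>y. norm (h y) \<le> B"
    then have b: "bounded (range h)" by (auto simp: bounded_iff)
    have "norm (Bcontfun h) \<le> B" by (rule norm_bound) (simp add: inv[OF b] B)
    then have "norm (Bcontfun h) * C \<le> C * B" using C(1) by (simp add: mult.commute)
    with C(2) show "norm (\<phi> (Bcontfun h)) \<le> C * B" by (rule order_trans)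
  qed
  with that show thesis by blast
qed

text \<open>It suffices that \<open>Bcontfun\<close> is continuous from the pointwise closure
  \<open>S\<close> of the translates to the weak topology, for then the image of the compact set
  \<open>S\<close> is weakly compact and contains the translates. Continuity is tested on one
  functional at a time, split into its atomic and diffuse parts.\<close>

lemma zero_cluster_imp_Wap:
  fixes \<omega> :: "'a::topological_group_add \<Rightarrow> real"
  assumes w: "weight \<omega>" and f: "f \<in> Cb_weighted \<omega>"
    and d: "discrete (UNIV :: 'a set)" and zc: "zero_cluster (Omega \<omega>)"
  shows "f \<in> Wap \<omega>"
proof -
  define t where "t x = apply_bcontfun (weighted_translate \<omega> f x)" for x
  obtain B where B: "0 < B" "\<And>x. norm (f x / complex_of_real (\<omega> x)) \<le> B"
    using Cb_weighted_bound[OF f] by blast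
  have le: "norm (t x y) \<le> B * norm (Omega \<omega> (y, x))" for x y
    unfolding t_def by (rule norm_weighted_translate_le[OF w f B(2)])
  have le': "norm (t x y) \<le> B" for x y
    using le[of x y] mult_left_mono[OF norm_Omega_le_1[OF w, of "(y, x)"], of B] B(1) by linarith
  define S where "S = closure (range t)"
  have S: "compact S" "\<And>s y. s \<in> S \<Longrightarrow> norm (s y) \<le> B"
    unfolding S_def by (rule compact_closure_uniformly_bounded; use le' in auto)+
  \<comment> \<open>Pointwise cluster points vanish at infinity: if \<open>s\<close> is large at
    every \<open>u n\<close>, distinct translates approximating \<open>s\<close> at more and more of
    these points give a grid on which \<Omega> is bounded below.\<close>
  have cluster_vanishes: "finite {y. \<delta> \<le> norm (s y)}"
    if s: "\<And>U. open U \<Longrightarrow> s \<in> U \<Longrightarrow> infinite {x. t x \<in> U}" and \<delta>: "0 < \<delta>" for s \<delta>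
  proof (rule ccontr)
    assume "infinite {y. \<delta> \<le> norm (s y)}"
    then obtain u :: "nat \<Rightarrow> 'a" where u: "inj u" "range u \<subseteq> {y. \<delta> \<le> norm (s y)}"
      using infinite_countable_subset by blast
    \<comment> \<open>At step \<open>n\<close> the set \<open>E\<close> has \<open>n\<close>
      elements, so \<open>card E\<close> recovers the step and the new translate is close to
      \<open>s\<close> at \<open>u 0, ..., u n\<close>.\<close>
    define P where "P E x \<longleftrightarrow> x \<notin> E \<and> (\<forall>y\<in>u ` {..card E}. dist (t x y) (s y) < \<delta> / 2)" for E x
    have "\<exists>v. \<forall>n :: nat. P (v ` {..<n}) (v n)"
    proof (rule exists_seq_avoiding)
      fix E :: "'a set" assume E: "finite E"
      have "infinite {x. t x \<in> {z. \<forall>y\<in>u ` {..card E}. dist (z y) (s y) < \<delta> / 2}}"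
        using \<delta> by (intro s open_pointwise_near) auto
      then have "infinite ({x. t x \<in> {z. \<forall>y\<in>u ` {..card E}. dist (z y) (s y) < \<delta> / 2}} - E)"
        using E by simp
      then show "\<exists>x. P E x" unfolding P_def using infinite_imp_nonempty by blast
    qed
    then obtain v where v: "\<And>n :: nat. P (v ` {..<n}) (v n)" by blast
    have v_inj: "inj v" by (rule inj_if_avoiding) (use v in \<open>auto simp: P_def\<close>)
    have "\<delta> / (2 * B) \<le> norm (Omega \<omega> (u n, v m))" if "n \<le> m" for n m
    proof -
      have "card (v ` {..<m}) = m" using v_inj by (simp add: card_image inj_on_subset)
      then have "dist (t (v m) (u n)) (s (u n)) < \<delta> / 2" using v[of m] that by (auto simp: P_def)
      moreover have "\<delta> \<le> norm (s (u n))" using u(2) by auto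
      ultimately have "\<delta> / 2 \<le> norm (t (v m) (u n))"
        using norm_triangle_ineq2[of "s (u n)" "t (v m) (u n)"] by (simp add: dist_norm norm_minus_commute)
      also have "\<dots> \<le> B * norm (Omega \<omega> (u n, v m))" by (rule le)
      finally show ?thesis using B(1) by (simp add: field_simps)
    qed
    then have "\<forall>n. eventually (\<lambda>m. \<delta> / (2 * B) \<le> norm (Omega \<omega> (u n, v m))) sequentially"
      unfolding eventually_sequentially by blast
    then show False
      using zero_cluster_no_grid(1)[OF zc norm_Omega_le_1[OF w] _ u(1) v_inj, of "\<delta> / (2 * B)"] \<delta> B(1) by simp
  qed
  have cont: "continuous_on S (\<lambda>s. \<phi> (Bcontfun s))" if \<phi>: "\<phi> \<in> Cb_dual" for \<phi> :: "('a \<Rightarrow>\<^sub>C complex) \<Rightarrow> complex"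
  proof -
    obtain C where "linf_functional (\<lambda>h. \<phi> (Bcontfun h)) C" using linf_functional_Cb_dual[OF d \<phi>] .
    then interpret \<phi>: linf_functional "\<lambda>h. \<phi> (Bcontfun h)" C .
    interpret df: diffuse_functional \<phi>.diffuse_part "2 * C"
      by (intro diffuse_functional.intro diffuse_functional_axioms.intro
        \<phi>.linf_functional_diffuse_part \<phi>.diffuse_part_finite_support)
    \<comment> \<open>Cutting off the finitely many places where \<open>s\<close> is at least
      \<epsilon> does not change the diffuse part, and what remains has norm at most
      \<epsilon>.\<close>
    have cluster: "\<phi>.diffuse_part s = 0" if s: "\<And>U. open U \<Longrightarrow> s \<in> U \<Longrightarrow> infinite {x. t x \<in> U}" for s
    proof (rule ccontr)
      assume "\<phi>.diffuse_part s \<noteq> 0"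
      then have pos: "0 < norm (\<phi>.diffuse_part s)" by simp
      \<comment> \<open>The summand 1 makes the final comparison of
        \<open>2 * C * \<epsilon>\<close> with the norm strict.\<close>
      define \<epsilon> where "\<epsilon> = norm (\<phi>.diffuse_part s) / (2 * C + 1)"
      have \<epsilon>: "0 < \<epsilon>" using pos df.C_nonneg by (simp add: \<epsilon>_def)
      define h where "h y = (if \<epsilon> \<le> norm (s y) then s y else 0)" for y
      define k where "k y = (if \<epsilon> \<le> norm (s y) then 0 else s y)" for y
      have fin: "finite {y. \<epsilon> \<le> norm (s y)}" by (rule cluster_vanishes[OF s \<epsilon>])
      have h0: "finite {y. h y \<noteq> 0}" by (rule finite_subset[OF _ fin]) (auto simp: h_def)
      have k\<epsilon>: "norm (k y) \<le> \<epsilon>" for y using \<epsilon> by (auto simp: k_def)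
      have "range h \<subseteq> insert 0 (h ` {y. h y \<noteq> 0})" by auto
      then have "bounded (range h)" using h0 by (meson bounded_subset finite_imageI finite_imp_bounded finite_insert)
      moreover have "bounded (range k)" using k\<epsilon> by (auto simp: bounded_iff)
      ultimately have "\<phi>.diffuse_part (\<lambda>y. h y + k y) = \<phi>.diffuse_part h + \<phi>.diffuse_part k" by (rule df.add)
      moreover have "(\<lambda>y. h y + k y) = s" by (auto simp: h_def k_def)
      ultimately have "\<phi>.diffuse_part s = \<phi>.diffuse_part k" using df.diffuse[OF h0] by simp
      then have "norm (\<phi>.diffuse_part s) \<le> 2 * C * \<epsilon>" using df.bound[of k \<epsilon>, OF k\<epsilon>] by simp
      also have "\<dots> < (2 * C + 1) * \<epsilon>" using \<epsilon> by (simp add: distrib_right)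
      also have "\<dots> = norm (\<phi>.diffuse_part s)" using df.C_nonneg by (simp add: \<epsilon>_def)
      finally show False by simp
    qed
    \<comment> \<open>A large diffuse part of a translate makes the set \<open>A x\<close>, where
      \<Omega> is not small, heavy. Infinitely many such sets yield a grid, this time contradicting
      the other order of limits.\<close>
    have fin: "finite {x. \<delta> \<le> norm (\<phi>.diffuse_part (t x))}" if \<delta>: "0 < \<delta>" for \<delta>
    proof (rule ccontr)
      assume inf: "infinite {x. \<delta> \<le> norm (\<phi>.diffuse_part (t x))}"
      \<comment> \<open>Chosen so that the part of a translate off \<open>A x\<close> contributes at
        most \<open>\<delta> / 2\<close>.\<close>
      define \<epsilon> where "\<epsilon> = \<delta> / (2 * (2 * C + 1) * B)"
      have pos: "0 < 2 * (2 * C + 1) * B" using df.C_nonneg B(1) by simp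
      have \<epsilon>: "0 < \<epsilon>" using \<delta> pos by (simp add: \<epsilon>_def)
      define A where "A x = {y. \<epsilon> \<le> norm (Omega \<omega> (y, x))}" for x
      have "df.heavy (A x) (\<delta> / (2 * B))" if x: "\<delta> \<le> norm (\<phi>.diffuse_part (t x))" for x
      proof -
        define h where "h y = (if y \<in> A x then t x y else 0)" for y
        define k where "k y = (if y \<in> A x then 0 else t x y)" for y
        have hB: "norm (h y) \<le> B" for y using le' B(1) by (simp add: h_def)
        have kB: "norm (k y) \<le> B * \<epsilon>" for y
        proof (cases "y \<in> A x")
          case True
          then show ?thesis using B(1) \<epsilon> by (simp add: k_def)
        next
          case False
          then have "B * norm (Omega \<omega> (y, x)) \<le> B * \<epsilon>" using B(1) by (intro mult_left_mono) (auto simp: A_def)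
          then show ?thesis using False le[of x y] by (simp add: k_def)
        qed
        have "bounded (range h)" "bounded (range k)" using hB kB by (auto simp: bounded_iff)
        then have "\<phi>.diffuse_part (\<lambda>y. h y + k y) = \<phi>.diffuse_part h + \<phi>.diffuse_part k" by (rule df.add)
        moreover have "(\<lambda>y. h y + k y) = t x" by (auto simp: h_def k_def)
        ultimately have "norm (\<phi>.diffuse_part (t x)) \<le> norm (\<phi>.diffuse_part h) + norm (\<phi>.diffuse_part k)"
          by (metis norm_triangle_ineq)
        moreover have "norm (\<phi>.diffuse_part k) \<le> 2 * C * (B * \<epsilon>)" by (rule df.bound[OF kB])
        moreover have "2 * C * (B * \<epsilon>) \<le> (2 * C + 1) * (B * \<epsilon>)" using B(1) \<epsilon> by (intro mult_right_mono) auto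
        moreover have "2 * (2 * C + 1) * B * \<epsilon> = \<delta>"
          unfolding \<epsilon>_def using less_imp_neq[OF pos] by (metis nonzero_mult_div_cancel_left times_divide_eq_right)
        then have "(2 * C + 1) * (B * \<epsilon>) = \<delta> / 2" by (simp add: algebra_simps)
        ultimately have half: "\<delta> / 2 \<le> norm (\<phi>.diffuse_part h)" using x by linarith
        \<comment> \<open>Normalisation to a test function bounded by 1, whence the mass
          \<open>\<delta> / (2 * B)\<close>.\<close>
        define h' where "h' y = complex_of_real (1 / B) * h y" for y
        have "\<phi>.diffuse_part h' = complex_of_real (1 / B) * \<phi>.diffuse_part h"
          unfolding h'_def by (rule df.scale) fact
        then have "norm (\<phi>.diffuse_part h') = norm (\<phi>.diffuse_part h) / B"
          using B(1) by (simp add: norm_mult norm_divide)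
        moreover have "\<delta> / (2 * B) \<le> norm (\<phi>.diffuse_part h) / B"
          using half B(1) by (simp add: field_simps)
        ultimately have "\<delta> / (2 * B) \<le> norm (\<phi>.diffuse_part h')" by simp
        moreover have "norm (h' y) \<le> 1" for y
          using hB[of y] B(1) by (simp add: h'_def norm_mult norm_divide)
        ultimately show ?thesis
          unfolding df.heavy_def by (intro exI[of _ h']) (auto simp: h'_def h_def)
      qed
      then have "infinite {x. df.heavy (A x) (\<delta> / (2 * B))}"
        using inf by (meson Collect_mono infinite_super)
      then obtain v u :: "nat \<Rightarrow> 'a" where uv: "inj v" "inj u" "\<And>n k. n \<le> k \<Longrightarrow> u k \<in> A (v n)"
        using df.infinitely_many_heavy_grid[of "\<delta> / (2 * B)" A] \<delta> B(1) by auto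
      then have "\<forall>m. eventually (\<lambda>n. \<epsilon> \<le> norm (Omega \<omega> (u n, v m))) sequentially"
        unfolding eventually_sequentially A_def by blast
      then show False
        using zero_cluster_no_grid(2)[OF zc norm_Omega_le_1[OF w] \<epsilon> uv(2,1)] by blast
    qed
    have "continuous_on S \<phi>.diffuse_part"
      unfolding S_def
    proof (rule continuous_on_closure_range_cluster)
      show "closed {s}" for s :: "'a \<Rightarrow> complex" by (rule closed_singleton_fun)
    qed (use fin cluster in blast)+
    moreover have "continuous_on S \<phi>.atomic_part" by (rule \<phi>.continuous_on_atomic_part) (rule S(2))
    ultimately have "continuous_on S (\<lambda>s. \<phi>.diffuse_part s + \<phi>.atomic_part s)" by (rule continuous_on_add)
    then show ?thesis by (simp add: \<phi>.diffuse_part_def)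
  qed
  have "continuous_map (top_of_set S) weak_topology_Cb Bcontfun"
    by (rule continuous_map_weak_topology_Cb) (use cont in auto)
  moreover have "compactin (top_of_set S) S" using S(1) by (simp add: compactin_subtopology)
  ultimately have "compactin weak_topology_Cb (Bcontfun ` S)" by (rule image_compactin[rotated])
  moreover have "range (weighted_translate \<omega> f) \<subseteq> Bcontfun ` S"
  proof (rule image_subsetI)
    fix x
    have "t x \<in> S" unfolding S_def by (intro subsetD[OF closure_subset] rangeI)
    then show "weighted_translate \<omega> f x \<in> Bcontfun ` S"
      by (rule rev_image_eqI) (simp add: t_def apply_bcontfun_inverse)
  qed
  ultimately show ?thesis using f by (simp add: Wap_def compactin_weak_closure)
qed

section \<open>Necessity of the conditions\<close>

lemma iterated_limit_subseq:
  assumes "iterated_limit F l" "strict_mono r" "strict_mono s"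
    and "\<And>n. eventually (\<lambda>m. G n m = F (r n) (s m)) sequentially"
  shows "iterated_limit G l"
proof -
  obtain L where L: "\<And>n. (\<lambda>m. F n m) \<longlonglongrightarrow> L n" "L \<longlonglongrightarrow> l"
    using assms(1) by (auto simp: iterated_limit_def)
  have "(\<lambda>m. G n m) \<longlonglongrightarrow> L (r n)" for n
  proof -
    have "(\<lambda>m. F (r n) (s m)) \<longlonglongrightarrow> L (r n)"
      using LIMSEQ_subseq_LIMSEQ[OF L(1) assms(3)] by (simp add: o_def)
    then show ?thesis using assms(4)[of n] by (simp add: tendsto_cong)
  qed
  moreover have "(\<lambda>n. L (r n)) \<longlonglongrightarrow> l" using LIMSEQ_subseq_LIMSEQ[OF L(2) assms(2)] by (simp add: o_def)
  ultimately show ?thesis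
    unfolding iterated_limit_def by (intro exI[of _ "\<lambda>n. L (r n)"]) blast
qed

lemma iterated_limit_eventually_zero:
  assumes "\<And>n. eventually (\<lambda>m. G n m = 0) sequentially"
  shows "iterated_limit G 0"
  unfolding iterated_limit_def
  using assms by (intro exI[of _ "\<lambda>_. 0"]) (auto intro: tendsto_eventually)

text \<open>Pairs of indices are chosen greedily; by injectivity each forbidden sum excludes only
  finitely many candidates. Two sums whose largest indices differ are separated because the later
  one avoids all earlier sums \<open>S E\<close>; if the largest indices agree, the last clause of
  \<open>P\<close> applies.\<close>

lemma separated_sums_subseq:
  fixes u v :: "nat \<Rightarrow> 'a::group_add"
  assumes u: "inj u" and v: "inj v"
  obtains r s where "strict_mono r" "strict_mono s"
    "\<And>i j k l :: nat. i < j \<Longrightarrow> l < k \<Longrightarrow> u (r i) + v (s j) \<noteq> u (r k) + v (s l)"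
proof -
  define S where "S E = (\<lambda>(p, q). u (fst p) + v (snd q)) ` (E \<times> E)" for E :: "(nat \<times> nat) set"
  define P where "P E p \<longleftrightarrow> (\<forall>q\<in>E. fst q < fst p \<and> snd q < snd p \<and> u (fst p) + v (snd q) \<notin> S E \<and>
      u (fst q) + v (snd p) \<notin> S E \<and> (\<forall>q'\<in>E. u (fst q) + v (snd p) \<noteq> u (fst p) + v (snd q')))" for E p
  have "\<exists>w. \<forall>n :: nat. P (w ` {..<n}) (w n)"
  proof (rule exists_seq_avoiding)
    fix E :: "(nat \<times> nat) set" assume E: "finite E"
    then have fS: "finite (S E)" by (simp add: S_def)
    have inj1: "inj (\<lambda>n. u n + c)" for c using u by (auto simp: inj_def)
    have inj2: "inj (\<lambda>m. c + v m)" for c using v by (auto simp: inj_def)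
    have "finite (\<Union>q\<in>E. {..fst q} \<union> (\<lambda>n. u n + v (snd q)) -` S E)"
      using E fS inj1 by (auto intro: finite_vimageI)
    then obtain n where n: "n \<notin> (\<Union>q\<in>E. {..fst q} \<union> (\<lambda>n. u n + v (snd q)) -` S E)"
      using ex_new_if_finite[OF infinite_UNIV_nat] by blast
    \<comment> \<open>The second index is picked after the first and must also avoid the sums that
      \<open>n\<close> has just created.\<close>
    define S' where "S' = S E \<union> (\<lambda>q. u n + v (snd q)) ` E"
    have "finite (\<Union>q\<in>E. {..snd q} \<union> (\<lambda>m. u (fst q) + v m) -` S')"
      using E fS inj2 by (auto simp: S'_def intro: finite_vimageI)
    then obtain m where m: "m \<notin> (\<Union>q\<in>E. {..snd q} \<union> (\<lambda>m. u (fst q) + v m) -` S')"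
      using ex_new_if_finite[OF infinite_UNIV_nat] by blast
    have "P E (n, m)" using n m unfolding P_def S'_def by (auto simp: not_le)
    then show "\<exists>p. P E p" by blast
  qed
  then obtain w where w: "\<And>n :: nat. P (w ` {..<n}) (w n)" by blast
  define r s where "r n = fst (w n)" and "s n = snd (w n)" for n
  have mono: "r i < r j" "s i < s j" if "i < j" for i j
    using w[of j] that by (auto simp: P_def r_def s_def)
  have SI: "u (r i) + v (s j) \<in> S (w ` {..<n})" if "i < n" "j < n" for i j n
    using that unfolding S_def r_def s_def by (intro image_eqI[of _ _ "(w i, w j)"]) auto
  have new1: "u (r k) + v (s l) \<notin> S (w ` {..<k})" if "l < k" for k l
    using w[of k] that by (auto simp: P_def r_def s_def)
  have new2: "u (r i) + v (s j) \<notin> S (w ` {..<j})" if "i < j" for i j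
    using w[of j] that by (auto simp: P_def r_def s_def)
  have new3: "u (r i) + v (s j) \<noteq> u (r j) + v (s l)" if "i < j" "l < j" for i j l
    using w[of j] that by (auto simp: P_def r_def s_def)
  show thesis
  proof (rule that[of r s])
    show "strict_mono r" "strict_mono s" using mono by (auto simp: strict_mono_def)
    fix i j k l :: nat assume *: "i < j" "l < k"
    consider "j < k" | "k < j" | "j = k" by linarith
    then show "u (r i) + v (s j) \<noteq> u (r k) + v (s l)"
    proof cases
      case 1
      then show ?thesis using new1[OF *(2)] SI[of i k j] * by auto
    next
      case 2
      then show ?thesis using new2[OF *(1)] SI[of k j l] * by auto
    next
      case 3
      then show ?thesis using new3 * by blast
    qed
  qed
qed

text \<open>Discreteness makes all indicator functions continuous, so \<omega> times any indicator
  is available as a test function.\<close>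

lemma Wap_eq_imp_zero_cluster:
  fixes \<omega> :: "'a::topological_group_add \<Rightarrow> real"
  assumes w: "weight \<omega>" and d: "discrete (UNIV :: 'a set)" and eq: "Wap \<omega> = Cb_weighted \<omega>"
  shows "zero_cluster (Omega \<omega>)"
  unfolding zero_cluster_def
proof (intro allI impI)
  fix u v :: "nat \<Rightarrow> 'a" and a b
  assume inj: "inj u" "inj v"
    and a: "iterated_limit (\<lambda>n m. Omega \<omega> (u n, v m)) a"
    and b: "iterated_limit (\<lambda>m n. Omega \<omega> (u n, v m)) b"
  obtain r s where rs: "strict_mono r" "strict_mono s" and
    sep: "\<And>i j k l :: nat. i < j \<Longrightarrow> l < k \<Longrightarrow> u (r i) + v (s j) \<noteq> u (r k) + v (s l)"
    using separated_sums_subseq[OF inj] by blast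
  define f where "f W z = complex_of_real (\<omega> z) * of_bool (z \<in> W)" for W z
  have fq: "f W z / complex_of_real (\<omega> z) = of_bool (z \<in> W)" for W z
    using weight_pos[OF w, of z] by (simp add: f_def)
  have "bounded (range (\<lambda>z. of_bool (z \<in> W) :: complex))" for W :: "'a set"
    by (rule boundedI[of _ 1]) auto
  then have "f W \<in> Cb_weighted \<omega>" for W
    by (simp add: Cb_weighted_def fq discrete_bounded_in_bcontfun[OF d])
  then have f: "f W \<in> Cb_weighted \<omega>" "f W \<in> Wap \<omega>" for W using eq by auto
  have T: "apply_bcontfun (weighted_translate \<omega> (f W) y) x = of_bool (x + y \<in> W) * Omega \<omega> (x, y)" for W x y
    by (simp add: apply_weighted_translate_Omega[OF w f(1)] fq)
  have gt: "eventually (\<lambda>m. n < m) sequentially" for n :: nat by (rule eventually_gt_at_top)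
  \<comment> \<open>\<open>W\<close> contains every sum above the diagonal and none below it. The
    iterated limits of the translates are therefore \<open>a\<close> and 0 for \<open>W\<close>, but
    0 and \<open>b\<close> for its complement; their equality gives both claims.\<close>
  define W where "W = {u (r i) + v (s j) | i j. i < j}"
  have W: "u (r i) + v (s j) \<in> W" if "i < j" for i j using that by (auto simp: W_def)
  have W': "u (r k) + v (s l) \<notin> W" if "l < k" for k l using sep[OF _ that] by (force simp: W_def)
  have evW: "eventually (\<lambda>m. u (r n) + v (s m) \<in> W) sequentially" for n
    by (rule eventually_mono[OF gt[of n]]) (rule W)
  have evW': "eventually (\<lambda>n. u (r n) + v (s m) \<notin> W) sequentially" for m
    by (rule eventually_mono[OF gt[of m]]) (rule W')
  define \<tau> where "\<tau> W n m = apply_bcontfun (weighted_translate \<omega> (f W) (v (s m))) (u (r n))" for W n m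
  have \<tau>: "\<tau> W n m = of_bool (u (r n) + v (s m) \<in> W) * Omega \<omega> (u (r n), v (s m))" for W n m
    by (simp add: \<tau>_def T)
  have "eventually (\<lambda>m. \<tau> W n m = Omega \<omega> (u (r n), v (s m))) sequentially" for n
    using evW[of n] by eventually_elim (simp add: \<tau>)
  then have 1: "iterated_limit (\<lambda>n m. \<tau> W n m) a" by (rule iterated_limit_subseq[OF a rs])
  have "eventually (\<lambda>n. \<tau> W n m = 0) sequentially" for m
    using evW'[of m] by eventually_elim (simp add: \<tau>)
  then have 2: "iterated_limit (\<lambda>m n. \<tau> W n m) 0" by (rule iterated_limit_eventually_zero)
  have "eventually (\<lambda>m. \<tau> (- W) n m = 0) sequentially" for n
    using evW[of n] by eventually_elim (simp add: \<tau>)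
  then have 3: "iterated_limit (\<lambda>n m. \<tau> (- W) n m) 0" by (rule iterated_limit_eventually_zero)
  have "eventually (\<lambda>n. \<tau> (- W) n m = Omega \<omega> (u (r n), v (s m))) sequentially" for m
    using evW'[of m] by eventually_elim (simp add: \<tau>)
  then have 4: "iterated_limit (\<lambda>m n. \<tau> (- W) n m) b" by (rule iterated_limit_subseq[OF b rs(2,1)])
  show "a = 0 \<and> b = 0"
    using Wap_iterated_limits_eq[OF f(2) 1[unfolded \<tau>_def] 2[unfolded \<tau>_def]]
      Wap_iterated_limits_eq[OF f(2) 3[unfolded \<tau>_def] 4[unfolded \<tau>_def]] by simp
qed

text \<open>The translates of \<omega> are the sections of \<Omega>. If \<Omega> stays large at
  pairs \<open>(u n, v n)\<close> of distinct points, a norm limit \<open>h\<close> of translates by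
  the \<open>v n\<close> is large at late \<open>u n\<close>; pointwise convergence to
  \<open>h\<close> then produces a grid excluded by zero cluster.\<close>

lemma Ap_weight_imp_C0_joint:
  fixes \<omega> :: "'a::topological_group_add \<Rightarrow> real"
  assumes w: "weight \<omega>" and zc: "zero_cluster (Omega \<omega>)"
    and Ap: "(\<lambda>x. complex_of_real (\<omega> x)) \<in> Ap \<omega>"
  shows "Omega \<omega> \<in> C0_joint"
proof (rule ccontr)
  assume "Omega \<omega> \<notin> C0_joint"
  have cw: "continuous_on UNIV \<omega>" using w by (simp add: weight_def)
  have nz: "\<omega> x \<noteq> 0" for x using weight_pos[OF w, of x] by simp
  have "continuous_on UNIV (\<lambda>p. complex_of_real (\<omega> (fst p + snd p) / (\<omega> (fst p) * \<omega> (snd p))))"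
    by (intro continuous_intros continuous_on_compose2[OF cw]) (auto simp: nz)
  then have "continuous_on UNIV (Omega \<omega>)" by (simp add: Omega_def case_prod_beta')
  then obtain \<epsilon> where \<epsilon>: "0 < \<epsilon>"
    "\<And>K. compact K \<Longrightarrow> \<exists>x y. x \<notin> K \<and> y \<notin> K \<and> \<epsilon> \<le> norm (Omega \<omega> (x, y))"
    using \<open>Omega \<omega> \<notin> C0_joint\<close> unfolding C0_joint_def by (auto simp: not_less)
  define P where "P E p \<longleftrightarrow> fst p \<notin> fst ` E \<and> snd p \<notin> snd ` E \<and> \<epsilon> \<le> norm (Omega \<omega> p)" for E p
  have "\<exists>z. \<forall>n :: nat. P (z ` {..<n}) (z n)"
  proof (rule exists_seq_avoiding)
    fix E :: "('a \<times> 'a) set" assume "finite E"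
    then have "compact (fst ` E \<union> snd ` E)" by (intro finite_imp_compact) simp
    from \<epsilon>(2)[OF this] obtain x y where "x \<notin> fst ` E \<union> snd ` E" "y \<notin> fst ` E \<union> snd ` E"
      "\<epsilon> \<le> norm (Omega \<omega> (x, y))" by blast
    then have "P E (x, y)" by (simp add: P_def)
    then show "\<exists>p. P E p" by blast
  qed
  then obtain z where z: "\<And>n :: nat. P (z ` {..<n}) (z n)" by blast
  define u v where "u n = fst (z n)" and "v n = snd (z n)" for n
  have "u n \<notin> u ` {..<n}" "v n \<notin> v ` {..<n}" for n
    using z[of n] by (auto simp: P_def u_def v_def image_image)
  then have inj: "inj u" "inj v" by (simp_all add: inj_if_avoiding)
  have ge: "\<epsilon> \<le> norm (Omega \<omega> (u n, v n))" for n using z[of n] by (simp add: P_def u_def v_def)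
  define T where "T = weighted_translate \<omega> (\<lambda>x. complex_of_real (\<omega> x))"
  have T: "apply_bcontfun (T y) x = Omega \<omega> (x, y)" for x y
    using Ap nz by (simp add: T_def Ap_def apply_weighted_translate_Omega[OF w])
  have "compact (closure (range T))" using Ap by (simp add: Ap_def T_def)
  then have "seq_compact (closure (range T))" by (rule compact_imp_seq_compact)
  moreover have "T (v n) \<in> closure (range T)" for n by (intro subsetD[OF closure_subset] rangeI)
  ultimately obtain h r where r: "strict_mono r" and h: "((\<lambda>n. T (v n)) \<circ> r) \<longlonglongrightarrow> h"
    using seq_compactE[of "closure (range T)" "\<lambda>n. T (v n)"] by metis
  have "eventually (\<lambda>n. dist (T (v (r n))) h < \<epsilon> / 2) sequentially"
    using tendstoD[OF h, of "\<epsilon> / 2"] \<epsilon>(1) by (simp add: o_def)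
  then obtain N where N: "\<And>n. N \<le> n \<Longrightarrow> dist (T (v (r n))) h < \<epsilon> / 2"
    unfolding eventually_sequentially by blast
  \<comment> \<open>The shift by \<open>N\<close> drops the terms at which the translate is not yet
    uniformly close to \<open>h\<close>.\<close>
  define u' where "u' n = u (r (n + N))" for n
  have lim: "(\<lambda>m. Omega \<omega> (x, v (r m))) \<longlonglongrightarrow> apply_bcontfun h x" for x
  proof -
    have "uniform_limit UNIV (\<lambda>m. apply_bcontfun (T (v (r m)))) (apply_bcontfun h) sequentially"
      using tendsto_bcontfun_uniform_limit[OF h] by (simp add: o_def)
    from tendsto_uniform_limitI[OF this, of x] show ?thesis by (simp add: T)
  qed
  have half: "\<epsilon> / 2 \<le> norm (apply_bcontfun h (u' n))" for n
  proof -
    have "dist (Omega \<omega> (u' n, v (r (n + N)))) (apply_bcontfun h (u' n)) < \<epsilon> / 2"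
      using dist_fun_lt_imp_dist_val_lt[OF N[of "n + N"], of "u' n"] by (simp add: T)
    moreover have "\<epsilon> \<le> norm (Omega \<omega> (u' n, v (r (n + N))))" using ge by (simp add: u'_def)
    ultimately show ?thesis
      using norm_triangle_ineq2[of "Omega \<omega> (u' n, v (r (n + N)))" "apply_bcontfun h (u' n)"]
      by (simp add: dist_norm)
  qed
  \<comment> \<open>A strict bound at the limit, so that it holds eventually along the
    sequence.\<close>
  have "\<epsilon> / 4 < norm (apply_bcontfun h (u' n))" for n
    using half[of n] \<epsilon>(1) by linarith
  then have "\<forall>n. eventually (\<lambda>m. \<epsilon> / 4 \<le> norm (Omega \<omega> (u' n, v (r m)))) sequentially"
    using order_tendstoD(1)[OF tendsto_norm[OF lim]] by (blast intro: eventually_mono less_imp_le)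
  moreover have "inj u'" "inj (\<lambda>m. v (r m))"
    by (auto intro!: injI simp: u'_def inj_eq[OF inj(1)] inj_eq[OF inj(2)] strict_mono_eq[OF r])
  ultimately show False
    using zero_cluster_no_grid(1)[OF zc norm_Omega_le_1[OF w], of "\<epsilon> / 4" u' "\<lambda>m. v (r m)"] \<epsilon>(1) by simp
qed

section \<open>Noncompact nondiscrete groups\<close>

lemma locally_compact_Urysohn:
  fixes F :: "'a::t2_space set"
  assumes lc: "locally_compact_space (euclidean :: 'a topology)" and F: "closed F" "x \<notin> F"
  obtains b :: "'a \<Rightarrow> real" where "continuous_on UNIV b" "\<And>z. 0 \<le> b z" "b x = 1" "\<And>z. z \<in> F \<Longrightarrow> b z = 0"
proof -
  have "Hausdorff_space (euclidean :: 'a topology)"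
    unfolding Hausdorff_space_def disjnt_def using hausdorff by auto
  then have "completely_regular_space (euclidean :: 'a topology)"
    by (intro locally_compact_regular_imp_completely_regular_space[OF lc] disjI1)
  then have "\<exists>f::'a \<Rightarrow> real. continuous_map euclidean (top_of_set {0..1}) f \<and> f x = 0 \<and> f ` F \<subseteq> {1}"
    using F unfolding completely_regular_space_def by auto
  then obtain f :: "'a \<Rightarrow> real" where f: "continuous_map euclidean (top_of_set {0..1}) f" "f x = 0" "f ` F \<subseteq> {1}"
    by blast
  have "continuous_on UNIV f" "\<And>z. f z \<le> 1"
    using f(1) by (auto simp: continuous_map_in_subtopology)
  then show thesis
    using f(2,3) by (intro that[of "\<lambda>z. 1 - f z"]) (auto intro!: continuous_intros)
qed

text \<open>For a noncompact, nondiscrete group take points \<open>u n\<close> accumulating at a point \<open>p\<close> of a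
  relatively compact open set \<open>W\<close>, and translates \<open>W + v m\<close> that are uniformly separated. Glueing
  bumps on the translates gives a function whose weighted translates have only weak cluster points
  vanishing at \<open>p\<close> but bounded away from zero at all \<open>u n \<noteq> p\<close>.\<close>

lemma exists_not_Wap:
  fixes \<omega> :: "'a::{topological_group_add, t2_space} \<Rightarrow> real"
  assumes lc: "locally_compact_space (euclidean :: 'a topology)" and w: "weight \<omega>"
    and nc: "\<not> compact (UNIV :: 'a set)" and nd: "\<not> discrete (UNIV :: 'a set)"
  obtains f where "f \<in> Cb_weighted \<omega>" "f \<notin> Wap \<omega>"
proof -
  obtain U K where U: "open U" "compact K" "(0 :: 'a) \<in> U" "U \<subseteq> K" "infinite U"
    using nondiscrete_infinite_compact_neighbourhood[OF lc nd] .
  have "infinite K" using U(4,5) finite_subset by blast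
  then obtain u :: "nat \<Rightarrow> 'a" where u: "inj u" "range u \<subseteq> K" using infinite_countable_subset by blast
  have "infinite (range u)" using u(1) by (simp add: finite_image_iff)
  then obtain p where p: "p \<in> K" "p islimpt (range u)"
    using Heine_Borel_imp_Bolzano_Weierstrass[OF U(2) _ u(2)] by blast
  \<comment> \<open>This is \<open>U + K\<close>, an open neighbourhood of \<open>K\<close> inside
    the compact set \<open>C = K + K\<close>.\<close>
  define W where "W = (\<Union>b\<in>K. (\<lambda>z. z - b) -` U)"
  have W: "open W" unfolding W_def using U(1) by (intro open_UN ballI open_vimage) (auto intro!: continuous_intros)
  have KW: "K \<subseteq> W" using U(3) by (auto simp: W_def)
  define C where "C = (\<lambda>(a, b). a + b) ` (K \<times> K)"
  have C: "compact C" unfolding C_def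
    by (intro compact_continuous_image compact_Times U(2)) (auto simp: case_prod_beta' intro!: continuous_intros)
  have WC: "W \<subseteq> C"
  proof
    fix z assume "z \<in> W"
    then obtain b where "b \<in> K" "z - b \<in> K" using U(4) by (auto simp: W_def)
    then show "z \<in> C" unfolding C_def by (intro image_eqI[of _ _ "(z - b, b)"]) auto
  qed
  \<comment> \<open>If some translate \<open>U + z\<close> meets both \<open>W + v i\<close> and
    \<open>W + v j\<close>, then \<open>v j - v i\<close> is of this form. Avoiding the compact set
    \<open>D\<close> therefore makes the sets \<open>W + v m\<close> uniformly separated.\<close>
  define D where "D = (\<lambda>(c, a, b, d). - c + (a + (- b + d))) ` (C \<times> K \<times> K \<times> C)"
  have D: "compact D" unfolding D_def
    by (intro compact_continuous_image compact_Times U(2) C) (auto simp: case_prod_beta' intro!: continuous_intros)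
  have "\<exists>v :: nat \<Rightarrow> 'a. \<forall>n. \<forall>y\<in>v ` {..<n}. v n - y \<notin> D"
  proof (rule exists_seq_avoiding)
    fix E :: "'a set" assume "finite E"
    then have "compact (\<Union>y\<in>E. (\<lambda>d. d + y) ` D)"
      by (intro compact_UN compact_continuous_image D) (auto intro!: continuous_intros)
    then have "(\<Union>y\<in>E. (\<lambda>d. d + y) ` D) \<noteq> UNIV" using nc by metis
    then obtain x where x: "x \<notin> (\<Union>y\<in>E. (\<lambda>d. d + y) ` D)" by blast
    have "x - y \<notin> D" if "y \<in> E" for y
    proof
      assume "x - y \<in> D"
      then have "x \<in> (\<lambda>d. d + y) ` D" by (rule rev_image_eqI) simp
      with x that show False by blast
    qed
    then show "\<exists>x. \<forall>y\<in>E. x - y \<notin> D" by blast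
  qed
  then obtain v :: "nat \<Rightarrow> 'a" where v: "\<And>i j. i < j \<Longrightarrow> v j - v i \<notin> D" by auto
  have sep: "False" if ij: "i < j" and z: "z1 - z \<in> U" "z2 - z \<in> U" "z1 - v j \<in> W" "z2 - v i \<in> W" for i j z z1 z2
  proof -
    have "v j - v i = - (z1 - v j) + ((z1 - z) + (- (z2 - z) + (z2 - v i)))"
      by (simp add: algebra_simps add.assoc[symmetric])
    also have "\<dots> \<in> D" unfolding D_def
      by (rule image_eqI[of _ _ "(z1 - v j, z1 - z, z2 - z, z2 - v i)"]) (use z WC U(4) in auto)
    finally show False using v[OF ij] by blast
  qed
  have sep': "i = j" if "z1 - z \<in> U" "z2 - z \<in> U" "z1 - v i \<in> W" "z2 - v j \<in> W" for i j z z1 z2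
    using sep[of i j z2 z z1] sep[of j i z1 z z2] that by (meson linorder_neqE_nat)
  \<comment> \<open>Bumps inside \<open>W\<close> that vanish at \<open>p\<close>; the zero function
    serves when \<open>u n = p\<close>.\<close>
  have "\<exists>b :: 'a \<Rightarrow> real. continuous_on UNIV b \<and> (\<forall>z. 0 \<le> b z) \<and> b p = 0 \<and> (\<forall>z. z \<notin> W \<longrightarrow> b z = 0) \<and>
      (u n \<noteq> p \<longrightarrow> b (u n) = 1)" for n
  proof (cases "u n = p")
    case True
    then show ?thesis by (intro exI[of _ "\<lambda>_. 0"]) auto
  next
    case False
    have "closed ({p} \<union> - W)" using W by (intro closed_Un) auto
    moreover have "u n \<notin> {p} \<union> - W" using False u(2) KW by auto
    ultimately obtain b :: "'a \<Rightarrow> real" where "continuous_on UNIV b" "\<And>z. 0 \<le> b z" "b (u n) = 1"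
      "\<And>z. z \<in> {p} \<union> - W \<Longrightarrow> b z = 0"
      using locally_compact_Urysohn[OF lc] by metis
    then show ?thesis by (intro exI[of _ b]) auto
  qed
  then obtain b :: "nat \<Rightarrow> 'a \<Rightarrow> real" where b: "\<And>n. continuous_on UNIV (b n)" "\<And>n z. 0 \<le> b n z"
    "\<And>n. b n p = 0" "\<And>n z. z \<notin> W \<Longrightarrow> b n z = 0" "\<And>n. u n \<noteq> p \<Longrightarrow> b n (u n) = 1"
    by metis
  \<comment> \<open>Truncated sums of bumps: \<open>k m\<close> is still 0 at \<open>p\<close> but
    equals 1 at all \<open>u n \<noteq> p\<close> with \<open>n < m\<close>.\<close>
  define k where "k m z = min 1 (\<Sum>n<m. b n z)" for m z
  have k: "continuous_on UNIV (k m)" "k m p = 0" "0 \<le> k m z" "k m z \<le> 1" "z \<notin> W \<Longrightarrow> k m z = 0" for m z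
    unfolding k_def[abs_def] using b by (auto intro!: continuous_intros sum_nonneg)
  have k1: "k m (u n) = 1" if "n < m" "u n \<noteq> p" for m n
  proof -
    have "b n (u n) \<le> (\<Sum>n'<m. b n' (u n))" by (rule member_le_sum) (use that b in auto)
    then show ?thesis using b(5)[OF that(2)] by (simp add: k_def)
  qed
  \<comment> \<open>A copy of \<open>k m\<close> on each \<open>W + v m\<close>; by separation the
    index chosen is the only possible one.\<close>
  define g where "g z = (if \<exists>m. z - v m \<in> W
      then k (SOME m. z - v m \<in> W) (z - v (SOME m. z - v m \<in> W)) else 0)" for z
  have g_glue: "g z = k m (z - v m)" if "z - v m \<in> W" for z m
  proof -
    have "(SOME m. z - v m \<in> W) = m"
      using someI[of "\<lambda>m. z - v m \<in> W", OF that] sep'[of z z z _ m] that U(3) by simp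
    then show ?thesis using that by (auto simp: g_def)
  qed
  \<comment> \<open>On \<open>U + z0\<close> at most one of the sets \<open>W + v m\<close> is met,
    so \<open>g\<close> agrees there with a single translated \<open>k m\<close> or with 0.\<close>
  have g_local: "\<exists>h. continuous_on UNIV h \<and> (\<forall>z. z - z0 \<in> U \<longrightarrow> g z = h z)" for z0
  proof (cases "\<exists>m z. z - z0 \<in> U \<and> z - v m \<in> W")
    case True
    then obtain m z1 where z1: "z1 - z0 \<in> U" "z1 - v m \<in> W" by blast
    have "g z = k m (z - v m)" if z: "z - z0 \<in> U" for z
    proof (cases "z - v m \<in> W")
      case False
      then have "z - v m' \<notin> W" for m' using sep'[OF z1(1) z z1(2), of m'] by blast
      then show ?thesis using k(5)[OF False] by (simp add: g_def)
    qed (rule g_glue)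
    moreover have "continuous_on UNIV (\<lambda>z. k m (z - v m))"
      by (intro continuous_on_compose2[OF k(1)] continuous_intros) simp
    ultimately show ?thesis by blast
  next
    case False
    then show ?thesis by (intro exI[of _ "\<lambda>_. 0"]) (auto simp: g_def)
  qed
  have "(g \<longlongrightarrow> g z0) (at z0)" for z0
  proof -
    obtain h where h: "continuous_on UNIV h" "\<And>z. z - z0 \<in> U \<Longrightarrow> g z = h z" using g_local by blast
    have "open ((\<lambda>z. z - z0) -` U)" by (intro open_vimage U(1) continuous_intros)
    then have "eventually (\<lambda>z. h z = g z) (at z0)"
      unfolding eventually_at_topological
      by (intro exI[of _ "(\<lambda>z. z - z0) -` U"]) (use h(2) U(3) in auto)
    moreover have "(h \<longlongrightarrow> h z0) (at z0)" using h(1) by (simp add: continuous_on_def)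
    ultimately have "(g \<longlongrightarrow> h z0) (at z0)" by (rule Lim_transform_eventually[rotated])
    then show ?thesis using h(2)[of z0] U(3) by simp
  qed
  then have cg: "continuous_on UNIV g" by (simp add: continuous_on_def)
  have g1: "norm (complex_of_real (g z)) \<le> 1" for z using k(3,4) by (simp add: g_def)
  define f where "f z = complex_of_real (\<omega> z) * complex_of_real (g z)" for z
  have fq: "f z / complex_of_real (\<omega> z) = complex_of_real (g z)" for z
    using weight_pos[OF w, of z] by (simp add: f_def)
  have f: "f \<in> Cb_weighted \<omega>"
    unfolding Cb_weighted_def fq mem_Collect_eq
    by (rule bcontfun_normI[OF _ g1]) (intro continuous_intros cg)
  define T where "T = weighted_translate \<omega> f"
  have T: "apply_bcontfun (T (v m)) z = complex_of_real (k m z) * Omega \<omega> (z, v m)" if "z \<in> W" for m z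
    using g_glue[of "z + v m" m] that
    by (simp add: T_def apply_weighted_translate_Omega[OF w f] fq)
  have "f \<notin> Wap \<omega>"
  proof
    assume "f \<in> Wap \<omega>"
    then have "compactin weak_topology_Cb (weak_topology_Cb closure_of range T)"
      by (simp add: Wap_def T_def)
    moreover have "T (v m) \<in> weak_topology_Cb closure_of range T" for m
      using closure_of_subset[of "range T" weak_topology_Cb] by auto
    ultimately obtain h where h: "\<And>\<phi> U. \<phi> \<in> Cb_dual \<Longrightarrow> open U \<Longrightarrow> \<phi> h \<in> U
        \<Longrightarrow> frequently (\<lambda>m. \<phi> (T (v m)) \<in> U) sequentially"
      using weak_cluster_point[of _ "\<lambda>m. T (v m)"] by metis
    have lim: "(\<lambda>m. apply_bcontfun (T (v m)) p) \<longlonglongrightarrow> 0" using p(1) KW by (simp add: T subset_iff k(2))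
    have hp: "apply_bcontfun h p = 0" by (rule frequently_tendsto_eq[OF h[OF eval_in_Cb_dual] lim])
    obtain c where c: "0 < c" "\<And>x y. x \<in> K \<Longrightarrow> c \<le> norm (Omega \<omega> (x, y))"
      using norm_Omega_bounded_below[OF w U(2)] by blast
    have hu: "c \<le> norm (apply_bcontfun h (u n))" if "u n \<noteq> p" for n
    proof (rule ccontr)
      assume "\<not> c \<le> norm (apply_bcontfun h (u n))"
      then have "apply_bcontfun h (u n) \<in> ball 0 c" by simp
      then have "frequently (\<lambda>m. apply_bcontfun (T (v m)) (u n) \<in> ball 0 c) sequentially"
        by (intro h eval_in_Cb_dual open_ball)
      then obtain m where m: "n < m" "norm (apply_bcontfun (T (v m)) (u n)) < c"
        unfolding frequently_sequentially by (auto dest!: spec[of _ "Suc n"] simp: Suc_le_eq)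
      have "u n \<in> K" using u(2) by blast
      then have "norm (apply_bcontfun (T (v m)) (u n)) = norm (Omega \<omega> (u n, v m))"
        using KW k1[OF m(1) that] by (simp add: T subset_iff)
      then show False using c(2)[OF \<open>u n \<in> K\<close>, of "v m"] m(2) by simp
    qed
    have "open (apply_bcontfun h -` ball 0 c)" by (intro open_vimage open_ball) simp
    moreover have "p \<in> apply_bcontfun h -` ball 0 c" using hp c(1) by simp
    ultimately obtain y where "y \<in> range u" "y \<in> apply_bcontfun h -` ball 0 c" "y \<noteq> p"
      using p(2) by (meson islimptE)
    then show False using hu by fastforce
  qed
  with f show thesis by (rule that)
qed

theorem theorem4p1:
  fixes \<omega> :: "'a::{topological_group_add, t2_space} \<Rightarrow> real"
  assumes "locally_compact_space (euclidean :: 'a topology)"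
    and "infinite (UNIV :: 'a set)"
    and "weight \<omega>"
  shows "(Wap \<omega> = Cb_weighted \<omega> \<longleftrightarrow> compact (UNIV :: 'a set) \<or> zero_cluster (Omega \<omega>)) \<and>
         (Ap \<omega> = Cb_weighted \<omega> \<longleftrightarrow>
            compact (UNIV :: 'a set) \<or> (discrete (UNIV :: 'a set) \<and> Omega \<omega> \<in> C0_joint))"
proof -
  note lc = assms(1) and inf = assms(2) and w = assms(3)
  \<comment> \<open>Through this implication the almost periodic case inherits discreteness and zero
    cluster from the weak case, and compactness yields both equalities at once.\<close>
  have Ap_Wap: "Ap \<omega> = Cb_weighted \<omega> \<Longrightarrow> Wap \<omega> = Cb_weighted \<omega>"
    using Ap_subset_Wap[of \<omega>] Wap_subset_Cb_weighted[of \<omega>] by blast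
  have compact: "Ap \<omega> = Cb_weighted \<omega>" if "compact (UNIV :: 'a set)"
    using compact_imp_Ap[OF w _ that] by (auto simp: Ap_def)
  have Wap: "discrete (UNIV :: 'a set)" "zero_cluster (Omega \<omega>)"
    if eq: "Wap \<omega> = Cb_weighted \<omega>" and nc: "\<not> compact (UNIV :: 'a set)"
  proof -
    show "discrete (UNIV :: 'a set)" using exists_not_Wap[OF lc w nc] eq by blast
    then show "zero_cluster (Omega \<omega>)" using Wap_eq_imp_zero_cluster[OF w _ eq] by blast
  qed
  have "Wap \<omega> = Cb_weighted \<omega>" if "zero_cluster (Omega \<omega>)"
    using zero_cluster_imp_Wap[OF w _ zero_cluster_imp_discrete[OF lc inf w that] that]
      Wap_subset_Cb_weighted[of \<omega>] by blast
  moreover have "Omega \<omega> \<in> C0_joint"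
    if eq: "Ap \<omega> = Cb_weighted \<omega>" and nc: "\<not> compact (UNIV :: 'a set)"
  proof (rule Ap_weight_imp_C0_joint[OF w Wap(2)[OF Ap_Wap[OF eq] nc]])
    have "(\<lambda>x. complex_of_real (\<omega> x) / complex_of_real (\<omega> x)) = (\<lambda>_. 1)"
      using weight_pos[OF w] by (auto simp: less_imp_neq[symmetric])
    then show "(\<lambda>x. complex_of_real (\<omega> x)) \<in> Ap \<omega>"
      by (simp add: eq Cb_weighted_def const_bcontfun)
  qed
  moreover have "Ap \<omega> = Cb_weighted \<omega>" if "discrete (UNIV :: 'a set)" "Omega \<omega> \<in> C0_joint"
    using C0_joint_imp_Ap[OF w _ that] by (auto simp: Ap_def)
  ultimately show ?thesis using Ap_Wap compact Wap by blast
qed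

end
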